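(* For $\sigma \in [0,2\pi]$, $\mathbf{k} = (k_{1}, \dots, k_{n}) \in \mathbb{N}^{n}$ and $\mathbf{l} = (l_{1},\dots,l_{n}) \in (\mathbb{Z}_{\ge 0})^{n}$ satisfying $k_{u} -1-l_{u} \ge 0$ for all $u \in \{1,\dots,n\}$, we have \[ \mathrm{Ls}_{\mathbf{k}}^{\mathbf{l}}(\sigma) =i^{|\mathbf{l}|+n}(-1)^{|\mathbf{k}|+n}\sum_{\mathbf{p}+\mathbf{q}+\mathbf{r}=\mathbf{k}-\mathbf{1}_{n}-\mathbf{l}}\frac{\left(-i\pi\right)^{|\mathbf{p}|}}{2^{|\mathbf{p}|+|\mathbf{q}|}}\binom{\mathbf{k}-\mathbf{1}_{n}-\mathbf{l}}{\mathbf{p},\mathbf{q},\mathbf{r}}F_{\mathbf{q}+\mathbf{l}}^{\mathbf{r}}(\sigma), \] where $\mathbf{1}_{n}=(\{1\}^{n})$, the sum is over all $\mathbf{p},\mathbf{q},\mathbf{r}\in(\mathbb{Z}_{\ge0})^{n}$ with $\mathbf{p}+\mathbf{q}+\mathbf{r}=\mathbf{k}-\mathbf{1}_{n}-\mathbf{l}$ (componentwise), and \[\binom{\mathbf{k}-\mathbf{1}_{n}-\mathbf{l}}{\mathbf{p},\mathbf{q},\mathbf{r}} = \prod_{u=1}^{n}\frac{(k_{u}-1-l_{u})!}{p_{u}!q_{u}!r_{u}!}.\]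
   Context: Notation: for an index $\mathbf{k}=(k_1,\dots,k_n)$, $|\mathbf{k}|=k_1+\dots+k_n$, $\mathrm{dep}(\mathbf{k})=n$, $\mathbf{k}_{-}=(k_1,\dots,k_{n-1})$; sums/differences of indices are componentwise. $A(\theta)=\log|2\sin(\theta/2)|$ and the iterated log-sine integral is $\mathrm{Ls}_{\mathbf{k}}^{\mathbf{l}}(\sigma)=(-1)^{n}\int_{0<\theta_1<\dots<\theta_n<\sigma}\prod_{u=1}^{n}\theta_u^{l_u}A(\theta_u)^{k_u-1-l_u}\,d\theta_1\cdots d\theta_n$. Multiple polylogarithms: $\mathrm{Li}_{\mathbf{k}}(z)=\sum_{0<m_1<\dots<m_n} z^{m_n}/(m_1^{k_1}\cdots m_n^{k_n})$ (holomorphically continued to $\mathbb{C}\setminus[1,\infty)$), $\mathrm{Li}_{\emptyset}=1$. Definition of $F$: Let $B_{\mathbf{q}}=\frac{1}{|\mathbf{q}|+n}B_{\mathbf{q}_-}$, $B_\emptyset=1$; $C_{\mathbf{q}}^{\mathbf{j}}=(-1)^{j_n}\frac{(|\mathbf{q}|-|\mathbf{j}_-|)!}{(|\mathbf{q}|-|\mathbf{j}|)!}C_{\mathbf{q}_-}^{\mathbf{j}_-}$, $C_\emptyset^\emptyset=1$. Write $\mathbf{j}\preceq\mathbf{q}$ if $j_1+\dots+j_s\le q_1+\dots+q_s$ for all $s$ (and $\emptyset\preceq\emptyset$). Let $\mathfrak{H}=\mathbb{Q}\langle e_0,e_1\rangle$, $\mathfrak{H}^1=\mathbb{Q}+e_1\mathfrak{H}$,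 with the shuffle product $\sqcup\!\sqcup$ defined by $w\sqcup\!\sqcup 1=1\sqcup\!\sqcup w=w$ and $u_1w_1\sqcup\!\sqcup u_2w_2=u_1(w_1\sqcup\!\sqcup u_2w_2)+u_2(u_1w_1\sqcup\!\sqcup w_2)$ ($u_1,u_2\in\{e_0,e_1\}$, words $w_1,w_2$), extended $\mathbb{Q}$-bilinearly. Define $w_{\mathbf{j}}^{\mathbf{r}}=(w_{\mathbf{j}_-}^{\mathbf{r}_-}\sqcup\!\sqcup e_1^{\sqcup\!\sqcup r_n})e_0^{1+j_n}$, $w_\emptyset^\emptyset=1$, where $e_1^{\sqcup\!\sqcup r}$ is the $r$-fold shuffle product of $e_1$ with itself. Define the $\mathbb{Q}$-linear map $L(\cdot;z):\mathfrak{H}^1\to\mathbb{C}$ by $L(e_1e_0^{k_1-1}\cdots e_1e_0^{k_n-1};z)=\mathrm{Li}_{k_1,\dots,k_n}(z)$, $L(1;z)=1$. For $\mathbf{q},\mathbf{r}\in(\mathbb{Z}_{\ge0})^n$ write $\mathbf{r}=(\{0\}^{n'},r''_1,\dots,r''_{n''})=(\mathbf{r}',\mathbf{r}'')$ with $r''_1\ge1$ (so $n'+n''=n$), $\mathbf{q}=(\mathbf{q}',\mathbf{q}'')$ with $\mathbf{q}'$ of length $n'$, and $\overline{\mathbf{q}}=(|\mathbf{q}'|+n'+q''_1,q''_2,\dots,q''_{n''})$ if $\mathbf{q}''\neq\emptyset$, $\overline{\mathbf{q}}=\emptyset$ otherwise. For $\sigma\in[0,2\pi]$ set $f_{\mathbf{q}}^{\mathbf{r}}(\sigma)=B_{\mathbf{q}'}\sum_{\mathbf{j}\preceq\overline{\mathbf{q}}}C_{\overline{\mathbf{q}}}^{\mathbf{j}}(i\sigma)^{|\mathbf{q}|+n'-|\mathbf{j}|}L(w_{\mathbf{j}}^{\mathbf{r}''};e^{i\sigma})$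 (sum over $\mathbf{j}\in(\mathbb{Z}_{\ge0})^{n''}$; so $f=1$ if $\mathbf{r}=\emptyset$ and $f=B_{\mathbf{q}}(i\sigma)^{|\mathbf{q}|+n}$ if $\mathbf{r}=(\{0\}^n)$, $n\ge1$), and $F_{\mathbf{q}}^{\mathbf{r}}(\sigma)=\sum(-1)^{h-1}\Bigl(\prod_{j=1}^{h-1}f_{\mathbf{q}^{(j)}}^{\mathbf{r}^{(j)}}(0)\Bigr)\bigl(f_{\mathbf{q}^{(h)}}^{\mathbf{r}^{(h)}}(\sigma)-f_{\mathbf{q}^{(h)}}^{\mathbf{r}^{(h)}}(0)\bigr)$, the sum over all decompositions $\mathbf{q}=(\mathbf{q}^{(1)},\dots,\mathbf{q}^{(h)})$, $\mathbf{r}=(\mathbf{r}^{(1)},\dots,\mathbf{r}^{(h)})$ into consecutive blocks with $\mathrm{dep}(\mathbf{q}^{(j)})=\mathrm{dep}(\mathbf{r}^{(j)})\ge1$; $F_\emptyset^\emptyset=1$. *)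

theory Defs
  imports "HOL-Analysis.Analysis"
begin

definition Acl :: "real \<Rightarrow> real" where
  "Acl \<theta> = ln \<bar>2 * sin (\<theta> / 2)\<bar>"

text \<open>Iterated integral over 0 < t_1 < ... < t_n < sigma, written as nested
  integrals; the index lists are given reversed (last component first).\<close>
fun Lsint_rev :: "nat list \<Rightarrow> nat list \<Rightarrow> real \<Rightarrow> real" where
  "Lsint_rev [] [] \<sigma> = 1"
| "Lsint_rev (k # ks) (l # ls) \<sigma> =
     (LBINT \<theta>=0..\<sigma>. \<theta> ^ l * Acl \<theta> ^ (k - 1 - l) * Lsint_rev ks ls \<theta>)"
| "Lsint_rev _ _ \<sigma> = 0"

definition Ls :: "nat list \<Rightarrow> nat list \<Rightarrow> real \<Rightarrow> real" where
  "Ls k l \<sigma> = (-1) ^ length k * Lsint_rev (rev k) (rev l) \<sigma>"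

text \<open>msum_rev [k_{n-1},...,k_1] N = sum over 0 < m_1 < ... < m_{n-1} < N of
  1/(m_1^k_1 ... m_{n-1}^k_{n-1}).\<close>
fun msum_rev :: "nat list \<Rightarrow> nat \<Rightarrow> complex" where
  "msum_rev [] N = 1"
| "msum_rev (a # ks) N = (\<Sum>m\<in>{1..<N}. msum_rev ks m / of_nat m ^ a)"

definition Li :: "nat list \<Rightarrow> complex \<Rightarrow> complex" where
  "Li ks z = (if ks = [] then 1 else
     (\<Sum>m. z ^ (m + 1) * msum_rev (rev (butlast ks)) (m + 1) / of_nat (m + 1) ^ last ks))"

datatype letter = E0 | E1

type_synonym word = "letter list"

text \<open>Elements of Q<e0,e1> as formal Q-linear combinations of words.\<close>
type_synonym hpoly = "(rat \<times> word) list"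

fun shw :: "word \<Rightarrow> word \<Rightarrow> word list" where
  "shw [] v = [v]"
| "shw u [] = [u]"
| "shw (a # u) (b # v) = map ((#) a) (shw u (b # v)) @ map ((#) b) (shw (a # u) v)"

definition shuffle :: "hpoly \<Rightarrow> hpoly \<Rightarrow> hpoly" where
  "shuffle X Y = concat (map (\<lambda>(c, u). concat (map (\<lambda>(d, v). map (\<lambda>w. (c * d, w)) (shw u v)) Y)) X)"

fun sh_pow :: "nat \<Rightarrow> hpoly" where
  "sh_pow 0 = [(1, [])]"
| "sh_pow (Suc r) = shuffle [(1, [E1])] (sh_pow r)"

fun wrev :: "nat list \<Rightarrow> nat list \<Rightarrow> hpoly" where
  "wrev [] [] = [(1, [])]"
| "wrev (j # js) (r # rs) =
     map (\<lambda>(c, u). (c, u @ replicate (Suc j) E0)) (shuffle (wrev js rs) (sh_pow r))"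
| "wrev _ _ = []"

definition wjr :: "nat list \<Rightarrow> nat list \<Rightarrow> hpoly" where
  "wjr js rs = wrev (rev js) (rev rs)"

text \<open>Index (k_1,...,k_n) of the word e1 e0^(k1-1) ... e1 e0^(kn-1).\<close>
definition word_index :: "word \<Rightarrow> nat list" where
  "word_index w = foldl (\<lambda>ks x. if x = E1 then ks @ [1] else butlast ks @ [Suc (last ks)]) [] w"

definition Lpoly :: "hpoly \<Rightarrow> complex \<Rightarrow> complex" where
  "Lpoly X z = (\<Sum>(c, u)\<leftarrow>X. of_rat c * Li (word_index u) z)"

fun B_rev :: "nat list \<Rightarrow> complex" where
  "B_rev [] = 1"
| "B_rev (a # qs) = B_rev qs / of_nat (sum_list (a # qs) + length (a # qs))"

definition Bc :: "nat list \<Rightarrow> complex" where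
  "Bc q = B_rev (rev q)"

fun C_rev :: "nat list \<Rightarrow> nat list \<Rightarrow> complex" where
  "C_rev [] [] = 1"
| "C_rev (a # qs) (b # js) =
     (-1) ^ b * (fact (sum_list (a # qs) - sum_list js) :: complex)
       / fact (sum_list (a # qs) - sum_list (b # js)) * C_rev qs js"
| "C_rev _ _ = 0"

definition Cc :: "nat list \<Rightarrow> nat list \<Rightarrow> complex" where
  "Cc q j = C_rev (rev q) (rev j)"

definition prec :: "nat list \<Rightarrow> nat list \<Rightarrow> bool" where
  "prec j q \<longleftrightarrow> length j = length q \<and>
     (\<forall>s\<le>length q. sum_list (take s j) \<le> sum_list (take s q))"

definition f_fun :: "nat list \<Rightarrow> nat list \<Rightarrow> real \<Rightarrow> complex" where
  "f_fun q r \<sigma> =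
    (let n' = length (takeWhile (\<lambda>x. x = 0) r);
         q1 = take n' q; q2 = drop n' q; r2 = drop n' r;
         qb = (if q2 = [] then [] else (sum_list q1 + n' + hd q2) # tl q2)
     in Bc q1 * (\<Sum>j\<in>{j. prec j qb}.
          Cc qb j * (\<i> * of_real \<sigma>) ^ (sum_list q + n' - sum_list j)
            * Lpoly (wjr j r2) (exp (\<i> * of_real \<sigma>))))"

definition comps :: "nat \<Rightarrow> nat list set" where
  "comps n = {c. (\<forall>x\<in>set c. 0 < x) \<and> sum_list c = n}"

definition blk :: "nat list \<Rightarrow> nat \<Rightarrow> 'a list \<Rightarrow> 'a list" where
  "blk c i xs = take (c ! i) (drop (sum_list (take i c)) xs)"

definition F_fun :: "nat list \<Rightarrow> nat list \<Rightarrow> real \<Rightarrow> complex" where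
  "F_fun q r \<sigma> = (if q = [] then 1 else
     (\<Sum>c\<in>comps (length q). (-1) ^ (length c - 1)
        * (\<Prod>i<length c - 1. f_fun (blk c i q) (blk c i r) 0)
        * (f_fun (blk c (length c - 1) q) (blk c (length c - 1) r) \<sigma>
           - f_fun (blk c (length c - 1) q) (blk c (length c - 1) r) 0)))"

end

theory Submission
  imports Defs
begin

text \<open>
  On \<open>0 < \<theta> < 2 \<pi>\<close> one has \<open>A(\<theta>) = - (Li\<^sub>1(e\<^sup>i\<^sup>\<theta>) + i \<theta> / 2 - i \<pi> / 2)\<close>, so expanding the
  powers of \<open>A\<close> by the trinomial theorem reduces the claim to: \<open>F\<close> is the iterated integral of the
  forms \<open>i (i \<theta>)\<^sup>q Li\<^sub>1(e\<^sup>i\<^sup>\<theta>)\<^sup>r d\<theta>\<close>. Each \<open>f\<close> is a primitive of such a form times the \<open>f\<close> of the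
  truncated index, by iterated integration by parts, where the shuffle product turns multiplication by
  \<open>Li\<^sub>1\<^sup>r\<close> into an operation on words; \<open>F\<close> corrects the constants of integration. Since \<open>Li\<^sub>1\<close> is
  only conditionally convergent on the unit circle, the primitive property is shown on circles of
  radius \<open>\<rho> < 1\<close> and carried over to \<open>\<rho> = 1\<close> by dominated convergence: the words occurring in \<open>f\<close>
  end in \<open>e\<^sub>0\<close>, so their series converge absolutely on the closed disc.
\<close>

text \<open>The shuffle identity is proved for formal power series, so convergence enters only
  afterwards and no analytic continuation occurs. The ingredients of \<open>f_fun\<close> come from
  repeated integration. As long as \<open>r\<close> vanishes, the integrand is a pure power of
  \<open>\<i> * \<theta>\<close> and each integration divides by the new exponent: this is
  \<open>Bc\<close>. The first factor Li_1 makes it a power times a series without constant term; t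
  integrations by parts then produce the signed falling factorial in \<open>Cc\<close> and t further
  letters \<open>E0\<close>, which is the meaning of \<open>j\<close>. The condition
  \<open>prec\<close> says that no power is differentiated beyond its degree. Primitives obtained by
  termwise integration of series need not vanish at 0; subtracting their values at 0 after every
  integration yields the alternating sum over block decompositions in \<open>F_fun\<close>.\<close>

unbundle no vec_syntax and fps_syntax

subsection \<open>Generating series of multiple polylogarithms and the shuffle product\<close>

text \<open>The inverse of the Euler operator \<open>z d/dz\<close> on series without constant term; a constant term is
  mapped to \<open>x / 0 = 0\<close>.\<close>
definition euler_int :: "complex fps \<Rightarrow> complex fps" where
  "euler_int f = Abs_fps (\<lambda>n. f $ n / of_nat n)"

text \<open>The word is reversed, since appending a letter at the end is what integrates against
  \<open>dz / z\<close> or \<open>dz / (1 - z)\<close>.\<close>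
fun polylog_rev :: "word \<Rightarrow> complex fps" where
  "polylog_rev [] = 1"
| "polylog_rev (E0 # w) = euler_int (polylog_rev w)"
| "polylog_rev (E1 # w) = Abs_fps (\<lambda>n. (\<Sum>m<n. polylog_rev w $ m) / of_nat n)"

definition polylog :: "word \<Rightarrow> complex fps" where
  "polylog w = polylog_rev (rev w)"

definition polylog_sum :: "hpoly \<Rightarrow> complex fps" where
  "polylog_sum X = (\<Sum>(c, u)\<leftarrow>X. fps_const (of_rat c) * polylog u)"

text \<open>The words spanning Q + e1 H. A word starting with \<open>E0\<close> would call for log
  z, which is no power series; \<open>polylog [E0]\<close> is 0 by division by zero.\<close>

definition admissible :: "word \<Rightarrow> bool" where
  "admissible w \<longleftrightarrow> w = [] \<or> hd w = E1"

text \<open>Denominators of the forms dz/z and dz/(1-z) attached to the letters.\<close>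

fun form_denom :: "letter \<Rightarrow> complex fps" where
  "form_denom E0 = fps_X"
| "form_denom E1 = 1 - fps_X"

lemma euler_int_nth [simp]: "euler_int f $ n = f $ n / of_nat n"
  by (simp add: euler_int_def)

lemma polylog_Nil [simp]: "polylog [] = 1"
  by (simp add: polylog_def)

lemma polylog_snoc_E0: "polylog (u @ [E0]) = euler_int (polylog u)"
  by (simp add: polylog_def)

lemma polylog_snoc_E1_nth: "polylog (u @ [E1]) $ n = (\<Sum>m<n. polylog u $ m) / of_nat n"
  by (simp add: polylog_def)

lemma polylog_nth_0 [simp]: "w \<noteq> [] \<Longrightarrow> polylog w $ 0 = 0"
  by (cases w rule: rev_cases; cases "last w") (auto simp: polylog_def)

text \<open>Multiplication by 1 - X turns the partial sums of the \<open>E1\<close> case back into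
  coefficients. In the \<open>E0\<close> case admissibility makes \<open>u\<close> nonempty, so the
  constant term that \<open>euler_int\<close> loses is 0.\<close>

lemma deriv_polylog_snoc:
  assumes "admissible (u @ [a])"
  shows "form_denom a * fps_deriv (polylog (u @ [a])) = polylog u"
proof (cases a)
  case E0
  hence "u \<noteq> []" using assms by (auto simp: admissible_def)
  thus ?thesis using E0
    by (intro fps_ext) (auto simp: polylog_snoc_E0 simp del: of_nat_Suc)
next
  case E1
  have "((1 - fps_X) * fps_deriv (polylog (u @ [E1]))) $ n = polylog u $ n" for n
    by (cases n) (auto simp: polylog_snoc_E1_nth left_diff_distrib simp del: of_nat_Suc)
  thus ?thesis using E1 by (intro fps_ext) simp
qed

lemma shw_Nil2 [simp]: "shw u [] = [u]"
  by (cases u) auto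

text \<open>Shuffles are defined by recursion on first letters, but differentiation removes last letters.\<close>
lemma sum_shw_snoc:
  fixes \<phi> :: "word \<Rightarrow> 'a::comm_monoid_add"
  shows "(\<Sum>w\<leftarrow>shw (u @ [a]) (v @ [b]). \<phi> w) =
    (\<Sum>w\<leftarrow>shw u (v @ [b]). \<phi> (w @ [a])) + (\<Sum>w\<leftarrow>shw (u @ [a]) v. \<phi> (w @ [b]))"
proof (induction u v arbitrary: \<phi> rule: shw.induct)
  case (1 v)
  show ?case
    by (induction v arbitrary: \<phi>) (auto simp: o_def algebra_simps)
next
  case (2 c u)
  show ?case
  proof (induction "c # u" arbitrary: c u \<phi>)
    case (Cons c u)
    show ?case
    proof (cases u)
      case Nil
      thus ?thesis by (simp add: o_def algebra_simps)
    next
      case (Cons d u')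
      show ?thesis using Cons.hyps[OF Cons, of "\<lambda>w. \<phi> (c # w)"] Cons
        by (simp add: o_def algebra_simps)
    qed
  qed
next
  case (3 c u d v)
  show ?case
    using "3.IH"(1)[of "\<lambda>w. \<phi> (c # w)"] "3.IH"(2)[of "\<lambda>w. \<phi> (d # w)"]
    by (simp add: o_def algebra_simps)
qed

lemma shw_not_Nil: "w \<in> set (shw u v) \<Longrightarrow> w = [] \<longleftrightarrow> u = [] \<and> v = []"
  by (induction u v rule: shw.induct) auto

lemma admissible_shw:
  "w \<in> set (shw u v) \<Longrightarrow> admissible u \<Longrightarrow> admissible v \<Longrightarrow> admissible w"
  by (induction u v rule: shw.induct) (auto simp: admissible_def)

lemma fps_deriv_sum_list: "fps_deriv (\<Sum>x\<leftarrow>xs. f x) = (\<Sum>x\<leftarrow>xs. fps_deriv (f x))"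
  by (induction xs) auto

text \<open>Both sides have the same derivative after multiplication with the denominators of the two last
  forms, and both have constant term \<open>0\<close>.\<close>
lemma sum_polylog_shw:
  "admissible u \<Longrightarrow> admissible v \<Longrightarrow> (\<Sum>w\<leftarrow>shw u v. polylog w) = polylog u * polylog v"
proof (induction "length u + length v" arbitrary: u v rule: less_induct)
  case less
  show ?case
  proof (cases "u = [] \<or> v = []")
    case True
    thus ?thesis by auto
  next
    case False
    then obtain u' a v' b where uv: "u = u' @ [a]" "v = v' @ [b]"
      by (metis rev_exhaust)
    have adm: "admissible u'" "admissible v'"
      using less.prems uv by (auto simp: admissible_def hd_append split: if_splits)
    have IH: "(\<Sum>w\<leftarrow>shw u' v. polylog w) = polylog u' * polylog v"
             "(\<Sum>w\<leftarrow>shw u v'. polylog w) = polylog u * polylog v'"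
      using less.hyps[of u' v] less.hyps[of u v'] less.prems adm uv by auto
    let ?S = "\<Sum>w\<leftarrow>shw u v. polylog w"
    have 1: "form_denom a * (\<Sum>w\<leftarrow>shw u' v. fps_deriv (polylog (w @ [a]))) = (\<Sum>w\<leftarrow>shw u' v. polylog w)"
      unfolding sum_list_const_mult[symmetric]
    proof (intro arg_cong[where f = sum_list] map_cong refl deriv_polylog_snoc)
      fix w assume w: "w \<in> set (shw u' v)"
      thus "admissible (w @ [a])"
        using admissible_shw[OF w adm(1) less.prems(2)] shw_not_Nil[OF w] uv
        by (auto simp: admissible_def)
    qed
    have 2: "form_denom b * (\<Sum>w\<leftarrow>shw u v'. fps_deriv (polylog (w @ [b]))) = (\<Sum>w\<leftarrow>shw u v'. polylog w)"
      unfolding sum_list_const_mult[symmetric]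
    proof (intro arg_cong[where f = sum_list] map_cong refl deriv_polylog_snoc)
      fix w assume w: "w \<in> set (shw u v')"
      thus "admissible (w @ [b])"
        using admissible_shw[OF w less.prems(1) adm(2)] shw_not_Nil[OF w] uv
        by (auto simp: admissible_def)
    qed
    have "form_denom a * form_denom b * fps_deriv ?S =
        form_denom b * (form_denom a * (\<Sum>w\<leftarrow>shw u' v. fps_deriv (polylog (w @ [a])))) +
        form_denom a * (form_denom b * (\<Sum>w\<leftarrow>shw u v'. fps_deriv (polylog (w @ [b]))))"
      by (simp add: fps_deriv_sum_list uv sum_shw_snoc algebra_simps)
    also have "\<dots> = form_denom b * (polylog u' * polylog v) + form_denom a * (polylog u * polylog v')"
      by (simp only: 1 2 IH)
    also have "\<dots> = form_denom b * ((form_denom a * fps_deriv (polylog u)) * polylog v) +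
        form_denom a * (polylog u * (form_denom b * fps_deriv (polylog v)))"
      using deriv_polylog_snoc[of u' a] deriv_polylog_snoc[of v' b] less.prems by (simp add: uv)
    also have "\<dots> = form_denom a * form_denom b * fps_deriv (polylog u * polylog v)"
      by (simp add: algebra_simps)
    finally have eq: "form_denom a * form_denom b * fps_deriv ?S =
      form_denom a * form_denom b * fps_deriv (polylog u * polylog v)" .
    \<comment> \<open>Formal power series form an integral domain, so both denominators cancel
      although \<open>fps_X\<close> is not invertible.\<close>
    have nz: "form_denom x \<noteq> 0" for x
    proof (cases x)
      case E1
      have "(1 - fps_X :: complex fps) $ 0 = 1" by simp
      thus ?thesis using E1 by (metis form_denom.simps(2) fps_zero_nth zero_neq_one)
    qed auto
    have D: "fps_deriv ?S = fps_deriv (polylog u * polylog v)"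
      using eq nz[of a] nz[of b] by simp
    have "w \<in> set (shw u v) \<Longrightarrow> polylog w $ 0 = 0" for w
      using shw_not_Nil[of w u v] uv by (intro polylog_nth_0) auto
    hence "(\<Sum>w\<leftarrow>ws. polylog w) $ 0 = 0" if "set ws \<subseteq> set (shw u v)" for ws
      using that by (induction ws) auto
    hence "?S $ 0 = (polylog u * polylog v) $ 0"
      using uv by simp
    with D show ?thesis
      unfolding fps_deriv_eq_iff by simp
  qed
qed

section \<open>Shuffle products of formal combinations of words\<close>

lemma polylog_sum_Nil [simp]: "polylog_sum [] = 0"
  and polylog_sum_Cons [simp]:
    "polylog_sum (x # X) = fps_const (of_rat (fst x)) * polylog (snd x) + polylog_sum X"
  and polylog_sum_append: "polylog_sum (X @ Y) = polylog_sum X + polylog_sum Y"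
  by (simp_all add: polylog_sum_def case_prod_beta)

lemma polylog_sum_map_const:
  "polylog_sum (map (\<lambda>w. (c, w)) ws) = fps_const (of_rat c) * (\<Sum>w\<leftarrow>ws. polylog w)"
  by (induction ws) (auto simp: algebra_simps)

lemma polylog_sum_shuffle:
  assumes "\<And>c u. (c, u) \<in> set X \<Longrightarrow> admissible u" "\<And>c u. (c, u) \<in> set Y \<Longrightarrow> admissible u"
  shows "polylog_sum (shuffle X Y) = polylog_sum X * polylog_sum Y"
proof -
  have *: "polylog_sum (concat (map (\<lambda>(d, v). map (\<lambda>w. (c * d, w)) (shw u v)) Y)) =
      fps_const (of_rat c) * polylog u * polylog_sum Y" if "admissible u" for c u
    using assms(2)
  proof (induction Y)
    case (Cons y Y)
    obtain d v where y: "y = (d, v)" by force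
    have "admissible v" using Cons.prems[of d v] y by simp
    hence "(\<Sum>w\<leftarrow>shw u v. polylog w) = polylog u * polylog v"
      using that sum_polylog_shw by blast
    moreover have "polylog_sum (concat (map (\<lambda>(d, v). map (\<lambda>w. (c * d, w)) (shw u v)) Y)) =
      fps_const (of_rat c) * polylog u * polylog_sum Y"
      using Cons by auto
    ultimately show ?case
      by (simp add: y polylog_sum_append polylog_sum_map_const of_rat_mult algebra_simps
            flip: fps_const_mult)
  qed simp
  show ?thesis
    using assms(1) unfolding shuffle_def
  proof (induction X)
    case (Cons x X)
    obtain c u where x: "x = (c, u)" by force
    have "admissible u" using Cons.prems[of c u] x by simp
    moreover have "\<And>c u. (c, u) \<in> set X \<Longrightarrow> admissible u"
      using Cons.prems by auto
    ultimately show ?case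
      using Cons.IH by (simp add: x polylog_sum_append * distrib_right)
  qed simp
qed

lemma set_shuffle:
  "(e, w) \<in> set (shuffle X Y) \<Longrightarrow>
    \<exists>c u d v. (c, u) \<in> set X \<and> (d, v) \<in> set Y \<and> w \<in> set (shw u v)"
  by (auto simp: shuffle_def)

lemma sh_pow_words: "(c, u) \<in> set (sh_pow r) \<Longrightarrow> admissible u \<and> (u = [] \<longleftrightarrow> r = 0)"
proof (induction r arbitrary: c u)
  case 0
  thus ?case by (auto simp: admissible_def)
next
  case (Suc r)
  then obtain d v where v: "(d, v) \<in> set (sh_pow r)" "u \<in> set (shw [E1] v)"
    using set_shuffle[of c u "[(1, [E1])]" "sh_pow r"] by auto
  show ?case
    using admissible_shw[OF v(2)] shw_not_Nil[OF v(2)] Suc.IH[OF v(1)]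
    by (auto simp: admissible_def)
qed

lemma polylog_sum_sh_pow: "polylog_sum (sh_pow r) = polylog [E1] ^ r"
proof (induction r)
  case (Suc r)
  have "polylog_sum (shuffle [(1, [E1])] (sh_pow r)) = polylog [E1] * polylog_sum (sh_pow r)"
    using sh_pow_words by (subst polylog_sum_shuffle) (auto simp: admissible_def)
  thus ?case using Suc by simp
qed simp

lemma euler_int_pow_nth: "(euler_int ^^ t) f $ n = f $ n / of_nat n ^ t"
  by (induction t) (auto simp: field_simps)

lemma polylog_append_E0s: "polylog (u @ replicate t E0) = (euler_int ^^ t) (polylog u)"
proof (induction t)
  case (Suc t)
  have "u @ replicate (Suc t) E0 = (u @ replicate t E0) @ [E0]"
    by (simp add: replicate_append_same)
  thus ?case using Suc by (simp only: polylog_snoc_E0 funpow.simps o_def)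
qed simp

lemma polylog_sum_append_E0s:
  "polylog_sum (map (\<lambda>(c, u). (c, u @ replicate t E0)) X) = (euler_int ^^ t) (polylog_sum X)"
  by (induction X)
    (auto intro!: fps_ext simp: polylog_append_E0s euler_int_pow_nth add_divide_distrib)

text \<open>Both lists are reversed, so \<open>last rs\<close> is the first component of the index.
  If it is positive, the innermost power of \<open>E1\<close> supplies the leading letter, and later
  shuffles of admissible words keep it. The trailing \<open>E0\<close> is what gives absolute
  convergence on the unit circle.\<close>

lemma wrev_words:
  assumes "length js = length rs" "rs \<noteq> []" "last rs > 0" "(c, u) \<in> set (wrev js rs)"
  shows "admissible u \<and> (\<exists>v. v \<noteq> [] \<and> u = v @ [E0])"
  using assms
proof (induction js rs arbitrary: c u rule: wrev.induct)
  case (2 j js r rs)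
  from "2.prems"(4) obtain v where v: "(c, v) \<in> set (shuffle (wrev js rs) (sh_pow r))"
    and u: "u = v @ replicate (Suc j) E0" by auto
  from set_shuffle[OF v(1)] obtain c1 u1 c2 u2 where w:
    "(c1, u1) \<in> set (wrev js rs)" "(c2, u2) \<in> set (sh_pow r)" "v \<in> set (shw u1 u2)" by blast
  have "admissible v \<and> v \<noteq> []"
  proof (cases "rs = []")
    case True
    hence "js = []" "r > 0" using "2.prems" by auto
    thus ?thesis using w True sh_pow_words[OF w(2)] by auto
  next
    case False
    thus ?thesis
      using "2.IH"[OF _ False _ w(1)] "2.prems" w sh_pow_words[OF w(2)]
        admissible_shw[OF w(3)] shw_not_Nil[OF w(3)] by auto
  qed
  moreover have "u = (v @ replicate j E0) @ [E0]"
    using u by (simp add: replicate_append_same)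
  ultimately show ?case by (auto simp: admissible_def)
qed auto

text \<open>On the level of series, one more component means multiplying by Li_1^r and applying
  Euler integration 1 + j times, which is the shape produced by integration by parts.\<close>

lemma polylog_sum_wrev_Cons:
  assumes "length js = length rs" "rs \<noteq> [] \<Longrightarrow> last rs > 0"
  shows "polylog_sum (wrev (j # js) (r # rs)) =
    (euler_int ^^ Suc j) (polylog_sum (wrev js rs) * polylog [E1] ^ r)"
proof -
  have "admissible u" if "(c, u) \<in> set (wrev js rs)" for c u
    using wrev_words[OF assms(1) _ _ that] assms that by (cases "rs = []") (auto simp: admissible_def)
  thus ?thesis
    using sh_pow_words
    by (simp only: wrev.simps polylog_sum_append_E0s polylog_sum_shuffle polylog_sum_sh_pow)
qed

subsection \<open>Convergence on the closed unit disc\<close>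

text \<open>Telescoping: for the roots s, t of n and n + 1, expanding (t - s)^2 \<ge> 0 with t^2 =
  s^2 + 1 gives 1 / t \<le> 2 (t - s).\<close>

lemma sum_le_sqrt:
  fixes a :: "nat \<Rightarrow> real"
  assumes "C \<ge> 0" "a 0 \<le> 1" "\<And>n. n \<ge> 1 \<Longrightarrow> a n \<le> C / sqrt (real n)"
  shows "(\<Sum>m\<le>n. a m) \<le> 1 + 2 * C * sqrt (real n)"
proof (induction n)
  case (Suc n)
  define s t where "s = sqrt (real n)" and "t = sqrt (real (Suc n))"
  have st: "s \<ge> 0" "t > 0" "s \<le> t" "t\<^sup>2 = s\<^sup>2 + 1" by (auto simp: s_def t_def)
  have "0 \<le> (t - s)\<^sup>2" by simp
  hence "1 \<le> 2 * (t - s) * t"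
    using st by (simp add: power2_eq_square algebra_simps)
  hence "1 / t \<le> 2 * (t - s)" using st by (simp add: field_simps)
  hence "C * (1 / t) \<le> C * (2 * (t - s))" using assms(1) by (rule mult_left_mono)
  hence "C / t \<le> 2 * C * (t - s)" by (simp add: algebra_simps)
  moreover have "a (Suc n) \<le> C / t" using assms(3)[of "Suc n"] by (simp add: t_def)
  ultimately show ?case
    using Suc by (simp add: s_def[symmetric] t_def[symmetric] algebra_simps del: of_nat_Suc)
qed (use assms in simp)

text \<open>The decay n^(-1/2) is not sharp, but both letters preserve it: for \<open>E1\<close> the
  partial sums grow at most like sqrt n, and the division by n restores n^(-1/2).\<close>

lemma norm_polylog_rev_nth_le:
  "norm (polylog_rev w $ 0) \<le> 1 \<and> (\<exists>C\<ge>0. \<forall>n\<ge>1. norm (polylog_rev w $ n) \<le> C / sqrt (real n))"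
proof (induction w)
  case Nil
  show ?case by (auto intro!: exI[of _ 0])
next
  case (Cons x w)
  then obtain C where C: "C \<ge> 0" "\<And>n. n \<ge> 1 \<Longrightarrow> norm (polylog_rev w $ n) \<le> C / sqrt (real n)"
    and w0: "norm (polylog_rev w $ 0) \<le> 1" by auto
  show ?case
  proof (cases x)
    case E0
    have "norm (polylog_rev w $ n / of_nat n) \<le> C / sqrt (real n)" if "n \<ge> 1" for n
    proof -
      have "norm (polylog_rev w $ n / of_nat n) \<le> norm (polylog_rev w $ n)"
        using that by (simp add: norm_divide divide_le_eq mult_le_cancel_left1)
      thus ?thesis using C(2)[OF that] by linarith
    qed
    thus ?thesis using C E0 by auto
  next
    case E1
    have "norm ((\<Sum>m<n. polylog_rev w $ m) / of_nat n) \<le> (1 + 2 * C) / sqrt (real n)" if "n \<ge> 1" for n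
    proof -
      have s: "sqrt (real n) \<ge> 1" using that by simp
      have "norm (\<Sum>m<n. polylog_rev w $ m) \<le> (\<Sum>m<n. norm (polylog_rev w $ m))"
        by (rule norm_sum)
      also have "\<dots> \<le> (\<Sum>m\<le>n. norm (polylog_rev w $ m))"
        by (intro sum_mono2) auto
      also have "\<dots> \<le> 1 + 2 * C * sqrt (real n)"
        by (intro sum_le_sqrt C w0)
      also have "\<dots> \<le> (1 + 2 * C) * sqrt (real n)"
        using s by (simp add: algebra_simps)
      finally have "norm ((\<Sum>m<n. polylog_rev w $ m) / of_nat n) \<le> (1 + 2 * C) * sqrt (real n) / real n"
        using that by (simp add: norm_divide divide_right_mono)
      also have "\<dots> = (1 + 2 * C) / sqrt (real n)"
        using that by (simp add: field_simps)
      finally show ?thesis .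
    qed
    moreover have "0 \<le> 1 + 2 * C" using C by simp
    ultimately show ?thesis using E1 by (auto intro!: exI[of _ "1 + 2 * C"])
  qed
qed

text \<open>The last \<open>E0\<close> contributes one more factor 1 / n, so the coefficients are
  O(n^(-3/2)).\<close>

lemma summable_polylog_snoc_E0: "summable (\<lambda>n. norm (polylog (u @ [E0]) $ n))"
proof -
  obtain C where C: "C \<ge> 0" "\<And>n. n \<ge> 1 \<Longrightarrow> norm (polylog u $ n) \<le> C / sqrt (real n)"
    using norm_polylog_rev_nth_le[of "rev u"] by (auto simp: polylog_def)
  show ?thesis
  proof (rule summable_comparison_test)
    show "summable (\<lambda>n. C * real n powr (-3/2))"
      by (intro summable_mult) (simp add: summable_real_powr_iff)
    have "norm (polylog (u @ [E0]) $ n) \<le> C * real n powr (-3/2)" if "n \<ge> 1" for n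
    proof -
      have "norm (polylog (u @ [E0]) $ n) = norm (polylog u $ n) / real n"
        by (simp add: polylog_snoc_E0 norm_divide)
      also have "\<dots> \<le> C / sqrt (real n) / real n"
        using C(2)[OF that] by (intro divide_right_mono) auto
      also have "\<dots> = C * (real n powr (-1/2) * real n powr (-1))"
        using that by (simp add: powr_half_sqrt powr_minus divide_simps)
      also have "\<dots> = C * real n powr (-3/2)"
        by (subst powr_add[symmetric]) simp
      finally show ?thesis .
    qed
    thus "\<exists>N. \<forall>n\<ge>N. norm (norm (polylog (u @ [E0]) $ n)) \<le> C * real n powr (-3/2)"
      by auto
  qed
qed

lemma conv_radius_ge_1_of_bounded:
  assumes "\<And>n. norm (a n) \<le> (C::real)"
  shows "conv_radius (a :: nat \<Rightarrow> complex) \<ge> 1"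
proof (rule conv_radius_geI_ex)
  fix r :: real assume r: "0 < r" "ereal r < 1"
  have "summable (\<lambda>n. a n * of_real r ^ n)"
  proof (rule summable_comparison_test)
    show "summable (\<lambda>n. C * r ^ n)" using r by (intro summable_mult summable_geometric) auto
    show "\<exists>N. \<forall>n\<ge>N. norm (a n * of_real r ^ n) \<le> C * r ^ n"
      using r assms by (auto simp: norm_mult norm_power intro!: mult_right_mono)
  qed
  thus "\<exists>z. norm z = r \<and> summable (\<lambda>n. a n * z ^ n)"
    using r by (intro exI[of _ "of_real r"]) auto
qed

lemma fps_conv_radius_ge_1:
  assumes "summable (\<lambda>n. norm (f $ n))"
  shows "fps_conv_radius (f :: complex fps) \<ge> 1"
proof -
  obtain C where "\<And>n. norm (norm (f $ n)) \<le> C"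
    using summable_imp_Bseq[OF assms] by (auto simp: Bseq_def)
  thus ?thesis unfolding fps_conv_radius_def by (intro conv_radius_ge_1_of_bounded) simp
qed

section \<open>Coefficients of words as nested sums, and values of Li\<close>

lemma word_index_snoc_E1: "word_index (w @ [E1]) = word_index w @ [1]"
  and word_index_snoc_E0: "word_index (w @ [E0]) = butlast (word_index w) @ [Suc (last (word_index w))]"
  by (simp_all add: word_index_def)

text \<open>Appending \<open>E0\<close> raises the last exponent; appending \<open>E1\<close> opens
  a new outermost summation, and its partial sums over \<open>m < n\<close> are the strict
  inequalities of \<open>msum_rev\<close>.\<close>

lemma polylog_nth:
  assumes "admissible w" "w \<noteq> []"
  shows "word_index w \<noteq> [] \<and> (\<forall>n\<ge>1. polylog w $ n =
    msum_rev (rev (butlast (word_index w))) n / of_nat n ^ last (word_index w))"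
  using assms
proof (induction w rule: rev_induct)
  case (snoc x w)
  show ?case
  proof (cases "w = []")
    case True
    hence x: "x = E1" using snoc.prems by (auto simp: admissible_def)
    have "(\<Sum>m<n. (1 :: complex fps) $ m) = 1" if "n \<ge> 1" for n
      using that by (induction n rule: dec_induct) auto
    hence "(\<Sum>m<n. polylog [] $ m) = 1" if "n \<ge> 1" for n
      using that by simp
    thus ?thesis using x True polylog_snoc_E1_nth[of "[]"] word_index_snoc_E1[of "[]"]
      by (auto simp: word_index_def)
  next
    case False
    hence "admissible w" using snoc.prems by (auto simp: admissible_def)
    with snoc.IH False have ne: "word_index w \<noteq> []" and IH: "\<And>n. n \<ge> 1 \<Longrightarrow> polylog w $ n =
      msum_rev (rev (butlast (word_index w))) n / of_nat n ^ last (word_index w)" by auto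
    show ?thesis
    proof (cases x)
      case E0
      thus ?thesis using IH by (simp add: word_index_snoc_E0 polylog_snoc_E0 mult.commute)
    next
      case E1
      have "(\<Sum>m<n. polylog w $ m) = msum_rev (rev (word_index w)) n" for n
      proof -
        \<comment> \<open>A nonempty word has constant term 0, so the sum may start at 1.\<close>
        have "(\<Sum>m<n. polylog w $ m) = (\<Sum>m\<in>{1..<n}. polylog w $ m)"
          using False by (intro sum.mono_neutral_right) (auto simp: not_le)
        also have "\<dots> = (\<Sum>m\<in>{1..<n}. msum_rev (rev (butlast (word_index w))) m / of_nat m ^ last (word_index w))"
          by (intro sum.cong IH) auto
        also have "\<dots> = msum_rev (last (word_index w) # rev (butlast (word_index w))) n"
          by simp
        also have "last (word_index w) # rev (butlast (word_index w)) = rev (word_index w)"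
          using ne by (metis append_butlast_last_id rev_eq_Cons_iff rev_rev_ident)
        finally show ?thesis .
      qed
      thus ?thesis using E1 by (simp add: word_index_snoc_E1 polylog_snoc_E1_nth)
    qed
  qed
qed simp

text \<open>\<open>Li\<close> is summed from exponent 1 on; a nonempty word has constant term 0, so
  splitting off the head of the convergent series loses nothing.\<close>

lemma Li_word_index:
  assumes "admissible w" "summable (\<lambda>n. polylog w $ n * z ^ n)"
  shows "Li (word_index w) z = eval_fps (polylog w) z"
proof (cases "w = []")
  case True
  thus ?thesis by (simp add: Li_def word_index_def)
next
  case False
  have "eval_fps (polylog w) z = (\<Sum>n. polylog w $ Suc n * z ^ Suc n)"
    unfolding eval_fps_def using suminf_split_head[OF assms(2)] False by simp
  also have "\<dots> = Li (word_index w) z"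
    using polylog_nth[OF assms(1) False] unfolding Li_def by (simp add: mult_ac)
  finally show ?thesis by simp
qed

lemma summable_fps_cball:
  fixes f :: "complex fps"
  assumes "summable (\<lambda>n. norm (f $ n))" "norm z \<le> 1"
  shows "summable (\<lambda>n. norm (f $ n * z ^ n))"
  using assms
  by (intro summable_comparison_test[OF _ assms(1)])
    (auto simp: norm_mult norm_power intro!: mult_left_le power_le_one)

lemma norm_eval_fps_le:
  fixes f :: "complex fps"
  assumes "summable (\<lambda>n. norm (f $ n))" "norm z \<le> 1"
  shows "norm (eval_fps f z) \<le> (\<Sum>n. norm (f $ n))"
proof -
  have "norm (eval_fps f z) \<le> (\<Sum>n. norm (f $ n * z ^ n))"
    unfolding eval_fps_def by (rule summable_norm[OF summable_fps_cball[OF assms]])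
  also have "\<dots> \<le> (\<Sum>n. norm (f $ n))"
    using assms(2)
    by (intro suminf_le summable_fps_cball assms)
      (auto simp: norm_mult norm_power intro!: mult_left_le power_le_one)
  finally show ?thesis .
qed

lemma continuous_on_eval_fps_cball:
  fixes f :: "complex fps"
  assumes "summable (\<lambda>n. norm (f $ n))"
  shows "continuous_on (cball 0 1) (eval_fps f)"
proof -
  have "uniform_limit (cball 0 1) (\<lambda>n z. \<Sum>i<n. f $ i * z ^ i) (\<lambda>z. \<Sum>i. f $ i * z ^ i) sequentially"
    using assms
    by (intro Weierstrass_m_test[OF _ assms])
      (auto simp: norm_mult norm_power intro!: mult_left_le power_le_one)
  hence "continuous_on (cball 0 1) (\<lambda>z. \<Sum>i. f $ i * z ^ i)"
    by (intro uniform_limit_theorem[OF always_eventually]) (auto intro!: continuous_intros)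
  thus ?thesis by (simp add: eval_fps_def[abs_def])
qed

lemma Lpoly_eq_eval_fps:
  assumes "\<And>c u. (c, u) \<in> set X \<Longrightarrow> admissible u \<and> summable (\<lambda>n. norm (polylog u $ n))"
  shows "summable (\<lambda>n. norm (polylog_sum X $ n)) \<and>
    (\<forall>z. norm z \<le> 1 \<longrightarrow> Lpoly X z = eval_fps (polylog_sum X) z)"
  using assms
proof (induction X)
  case Nil
  show ?case by (simp add: Lpoly_def)
next
  case (Cons x X)
  obtain c u where x: "x = (c, u)" by force
  have u: "admissible u" "summable (\<lambda>n. norm (polylog u $ n))" using Cons.prems[of c u] x by auto
  have IH: "summable (\<lambda>n. norm (polylog_sum X $ n))"
    "\<And>z. norm z \<le> 1 \<Longrightarrow> Lpoly X z = eval_fps (polylog_sum X) z"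
    using Cons.IH[OF Cons.prems] by (meson list.set_intros(2))+
  have s: "summable (\<lambda>n. norm (of_rat c) * norm (polylog u $ n) + norm (polylog_sum X $ n))"
    by (intro summable_add summable_mult u IH)
  have 1: "summable (\<lambda>n. norm (polylog_sum (x # X) $ n))"
    by (rule summable_comparison_test[OF _ s])
      (auto simp: x norm_mult intro!: exI[of _ 0] order_trans[OF norm_triangle_ineq])
  have "Lpoly (x # X) z = eval_fps (polylog_sum (x # X)) z" if z: "norm z \<le> 1" for z
  proof -
    have su: "summable (\<lambda>n. polylog u $ n * z ^ n)" "summable (\<lambda>n. polylog_sum X $ n * z ^ n)"
      by (rule summable_norm_cancel, rule summable_fps_cball; fact)+
    have "Lpoly (x # X) z = of_rat c * Li (word_index u) z + Lpoly X z"
      by (simp add: Lpoly_def x)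
    also have "\<dots> = of_rat c * eval_fps (polylog u) z + eval_fps (polylog_sum X) z"
      using Li_word_index[OF u(1) su(1)] IH(2)[OF z] by simp
    also have "\<dots> = (\<Sum>n. of_rat c * (polylog u $ n * z ^ n) + polylog_sum X $ n * z ^ n)"
      unfolding eval_fps_def
      by (simp add: suminf_add[symmetric] suminf_mult su summable_mult)
    also have "\<dots> = eval_fps (polylog_sum (x # X)) z"
      by (simp add: eval_fps_def x algebra_simps)
    finally show ?thesis .
  qed
  with 1 show ?case by blast
qed

subsection \<open>Primitives on the unit circle\<close>

lemma euler_int_deriv:
  assumes "f $ 0 = 0"
  shows "fps_X * fps_deriv (euler_int f) = f"
proof (rule fps_ext)
  fix n show "(fps_X * fps_deriv (euler_int f)) $ n = f $ n"
    using assms by (cases n) (auto simp del: of_nat_Suc)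
qed

lemma norm_euler_int_pow_nth_le:
  assumes "s \<le> t"
  shows "norm ((euler_int ^^ t) f $ n) \<le> norm ((euler_int ^^ s) f $ n)"
proof (cases "n = 0")
  case True
  \<comment> \<open>At index 0 every positive power of \<open>euler_int\<close> gives 0, by division
    by zero.\<close>
  show ?thesis using assms True by (cases s; cases t) (auto simp: euler_int_pow_nth)
next
  case False
  hence "real n ^ s \<le> real n ^ t" using assms by (intro power_increasing) auto
  thus ?thesis using False
    by (auto simp: euler_int_pow_nth norm_divide norm_power intro!: divide_left_mono)
qed

lemma summable_euler_int_pow:
  assumes "summable (\<lambda>n. norm (euler_int g $ n))"
  shows "summable (\<lambda>n. norm ((euler_int ^^ Suc t) g $ n))"
  using norm_euler_int_pow_nth_le[of 1 "Suc t" g]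
  by (intro summable_comparison_test[OF _ assms]) auto

text \<open>For \<open>z = r * exp (\<i> * w)\<close> one has d/dw = \<i> z d/dz, so Euler
  integration is, up to the factor \<open>\<i>\<close>, integration in the angle.\<close>

lemma has_field_derivative_eval_fps_circle:
  assumes "f $ 0 = 0" "fps_conv_radius (euler_int f) \<ge> 1" "norm (r * exp (\<i> * w)) < 1"
  shows "((\<lambda>w. eval_fps (euler_int f) (r * exp (\<i> * w))) has_field_derivative
    \<i> * eval_fps f (r * exp (\<i> * w))) (at w within A)"
proof -
  let ?z = "r * exp (\<i> * w)" and ?E = "euler_int f"
  have r: "ereal (norm ?z) < 1" using assms(3) by simp
  have z: "ereal (norm ?z) < fps_conv_radius ?E"
    by (rule order_less_le_trans[OF r assms(2)])
  have "fps_conv_radius (fps_deriv ?E) \<ge> 1"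
    using assms(2) fps_conv_radius_deriv[of ?E] by (rule order_trans)
  hence "ereal (norm ?z) < fps_conv_radius (fps_deriv ?E)"
    by (rule order_less_le_trans[OF r])
  hence "eval_fps f ?z = ?z * eval_fps (fps_deriv ?E) ?z"
    by (subst euler_int_deriv[OF assms(1), symmetric], subst eval_fps_mult) auto
  moreover have "((\<lambda>w. eval_fps ?E (r * exp (\<i> * w))) has_field_derivative
      eval_fps (fps_deriv ?E) ?z * (\<i> * ?z)) (at w within A)"
    by (rule DERIV_chain2[where f = "eval_fps ?E", OF has_field_derivative_eval_fps])
      (use z in \<open>auto intro!: derivative_eq_intros\<close>)
  ultimately show ?thesis by (simp add: mult_ac)
qed

text \<open>The result of integrating \<open>i (i w)\<^sup>M g(\<rho> e\<^sup>i\<^sup>w)\<close> by parts \<open>M\<close> times; for \<open>\<rho> = 1\<close> this is the inner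
  sum over the last component of \<open>j\<close> in \<open>f\<close>.\<close>
definition circle_primitive :: "nat \<Rightarrow> complex fps \<Rightarrow> real \<Rightarrow> complex \<Rightarrow> complex" where
  "circle_primitive M g \<rho> w = (\<Sum>t\<le>M. (-1) ^ t * (fact M / fact (M - t)) * (\<i> * w) ^ (M - t) *
     eval_fps ((euler_int ^^ Suc t) g) (of_real \<rho> * exp (\<i> * w)))"

text \<open>By the product rule each summand yields two terms; the one from the power of
  \<open>\<i> * w\<close> in summand t cancels the one from the series in summand t + 1. For t = M
  the power is constant, so only the series term of t = 0 survives.\<close>

lemma circle_primitive_derivative:
  assumes "g $ 0 = 0" "summable (\<lambda>n. norm (euler_int g $ n))" "norm (of_real \<rho> * exp (\<i> * w)) < 1"
  shows "(circle_primitive M g \<rho> has_field_derivative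
    \<i> * (\<i> * w) ^ M * eval_fps g (of_real \<rho> * exp (\<i> * w))) (at w)"
proof -
  define J where "J = (\<lambda>t. eval_fps ((euler_int ^^ t) g) (of_real \<rho> * exp (\<i> * w)))"
  define c :: "nat \<Rightarrow> complex" where "c = (\<lambda>t. (-1) ^ t * (fact M / fact (M - t)))"
  \<comment> \<open>The cutoff beyond \<open>M\<close> makes the telescoping sum end in
    \<open>a (Suc M) = 0\<close>.\<close>
  define a where "a = (\<lambda>t. if t \<le> M then \<i> * c t * (\<i> * w) ^ (M - t) * J t else 0)"
  have dJ: "((\<lambda>w. eval_fps ((euler_int ^^ Suc t) g) (of_real \<rho> * exp (\<i> * w))) has_field_derivative \<i> * J t) (at w)" for t
    using has_field_derivative_eval_fps_circle[of "(euler_int ^^ t) g" "of_real \<rho>" w UNIV]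
      fps_conv_radius_ge_1[OF summable_euler_int_pow[OF assms(2), of t]] assms(1,3)
    by (auto simp: euler_int_pow_nth J_def)
  have c_Suc: "c (Suc t) = - c t * of_nat (M - t)" if "t < M" for t
  proof -
    have "M - t = Suc (M - Suc t)" using that by simp
    hence "fact (M - t) = of_nat (M - t) * (fact (M - Suc t) :: complex)"
      by (metis fact_Suc of_nat_mult of_nat_fact)
    thus ?thesis using that by (simp add: c_def)
  qed
  have "(circle_primitive M g \<rho> has_field_derivative (\<Sum>t\<le>M. c t *
      (of_nat (M - t) * (\<i> * w) ^ (M - t - 1) * \<i> * J (Suc t) + (\<i> * w) ^ (M - t) * (\<i> * J t)))) (at w)"
    unfolding circle_primitive_def[abs_def] c_def
    by (rule derivative_eq_intros dJ refl)+ (auto simp: J_def algebra_simps intro!: sum.cong)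
  also have "(\<Sum>t\<le>M. c t *
      (of_nat (M - t) * (\<i> * w) ^ (M - t - 1) * \<i> * J (Suc t) + (\<i> * w) ^ (M - t) * (\<i> * J t))) =
      (\<Sum>t\<le>M. a t - a (Suc t))"
    by (intro sum.cong refl) (auto simp: a_def c_Suc algebra_simps Suc_le_eq le_less)
  also have "\<dots> = a 0 - a (Suc M)" by (rule sum_telescope)
  also have "\<dots> = \<i> * (\<i> * w) ^ M * eval_fps g (of_real \<rho> * exp (\<i> * w))"
    by (simp add: a_def c_def J_def)
  finally show ?thesis .
qed

lemma circle_primitive_tendsto:
  assumes "summable (\<lambda>n. norm (euler_int g $ n))"
  shows "(\<lambda>k. circle_primitive M g (1 - inverse (real (Suc k))) (of_real s)) \<longlonglongrightarrow>
    circle_primitive M g 1 (of_real s)"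
  unfolding circle_primitive_def
proof (intro tendsto_intros)
  fix t
  let ?z = "\<lambda>k. complex_of_real (1 - inverse (real (Suc k))) * exp (\<i> * complex_of_real s)"
  have "summable (\<lambda>n. norm ((euler_int ^^ Suc t) g $ n))"
    by (rule summable_euler_int_pow[OF assms])
  moreover have "?z \<longlonglongrightarrow> of_real (1 - 0) * exp (\<i> * of_real s)"
    by (intro tendsto_intros LIMSEQ_inverse_real_of_nat)
  moreover have "norm (complex_of_real (1 - inverse (real (Suc k)))) \<le> 1" for k
    by (simp only: norm_of_real) (simp add: field_simps)
  hence "?z k \<in> cball 0 1" for k
    by (simp only: mem_cball_0 norm_mult norm_exp_i_times mult_1_right)
  ultimately show "(\<lambda>k. eval_fps ((euler_int ^^ Suc t) g) (?z k)) \<longlonglongrightarrow>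
      eval_fps ((euler_int ^^ Suc t) g) (of_real 1 * exp (\<i> * of_real s))"
    by (intro continuous_on_tendsto_compose[OF continuous_on_eval_fps_cball]) auto
qed

text \<open>\<open>g\<close> need not converge absolutely on the circle, so its radial limit
  \<open>h\<close> and a majorant \<open>D\<close> independent of the radius are hypotheses. The
  primitives converge because \<open>euler_int g\<close> is absolutely summable.\<close>

lemma has_integral_circle_primitive:
  assumes "g $ 0 = 0" "summable (\<lambda>n. norm (euler_int g $ n))" "0 \<le> \<sigma>"
    and D: "D integrable_on {0..\<sigma>}"
    and bound: "\<And>\<rho> \<theta>. 0 \<le> \<rho> \<Longrightarrow> \<rho> < 1 \<Longrightarrow> 0 < \<theta> \<Longrightarrow> \<theta> < \<sigma> \<Longrightarrow>
      norm (eval_fps g (of_real \<rho> * exp (\<i> * of_real \<theta>))) \<le> D \<theta>"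
    and lim: "\<And>\<theta>. 0 < \<theta> \<Longrightarrow> \<theta> < \<sigma> \<Longrightarrow>
      (\<lambda>k. eval_fps g (of_real (1 - inverse (real (Suc k))) * exp (\<i> * of_real \<theta>))) \<longlonglongrightarrow> h \<theta>"
  shows "((\<lambda>\<theta>. \<i> * (\<i> * of_real \<theta>) ^ M * h \<theta>) has_integral
    circle_primitive M g 1 (of_real \<sigma>) - circle_primitive M g 1 0) {0..\<sigma>}"
proof -
  define \<rho> where "\<rho> = (\<lambda>k. 1 - inverse (real (Suc k)))"
  have \<rho>: "0 \<le> \<rho> k" "\<rho> k < 1" for k by (auto simp: \<rho>_def field_simps)
  have n: "norm (of_real (\<rho> k) * exp (\<i> * complex_of_real s)) < 1" for k s
    using \<rho>[of k] by (simp add: norm_mult)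
  have int: "((\<lambda>\<theta>. \<i> * (\<i> * of_real \<theta>) ^ M * eval_fps g (of_real (\<rho> k) * exp (\<i> * of_real \<theta>))) has_integral
    circle_primitive M g (\<rho> k) (of_real \<sigma>) - circle_primitive M g (\<rho> k) (of_real 0)) {0..\<sigma>}" for k
    using assms n
    by (intro fundamental_theorem_of_calculus has_vector_derivative_real_field circle_primitive_derivative)
  \<comment> \<open>Bound and limit are available only inside the interval; its end points form a
    null set.\<close>
  have "((\<lambda>\<theta>. \<i> * (\<i> * of_real \<theta>) ^ M * h \<theta>) has_integral
    circle_primitive M g 1 (of_real \<sigma>) - circle_primitive M g 1 (of_real 0)) {0<..<\<sigma>}"
  proof (rule has_integral_dominated_convergence)
    show "((\<lambda>\<theta>. \<i> * (\<i> * of_real \<theta>) ^ M * eval_fps g (of_real (\<rho> k) * exp (\<i> * of_real \<theta>))) has_integral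
      circle_primitive M g (\<rho> k) (of_real \<sigma>) - circle_primitive M g (\<rho> k) (of_real 0)) {0<..<\<sigma>}" for k
      using int[of k] by (simp add: has_integral_Icc_iff_Ioo)
    show "(\<lambda>\<theta>. \<sigma> ^ M * D \<theta>) integrable_on {0<..<\<sigma>}"
      using D by (intro integrable_on_mult_right) (simp add: integrable_on_Icc_iff_Ioo)
    show "\<forall>\<theta>\<in>{0<..<\<sigma>}. norm (\<i> * (\<i> * of_real \<theta>) ^ M * eval_fps g (of_real (\<rho> k) * exp (\<i> * of_real \<theta>))) \<le> \<sigma> ^ M * D \<theta>"
      for k
      using bound[OF \<rho>, of _ k]
      by (auto simp: norm_mult norm_power intro!: mult_mono power_mono)
    show "\<forall>\<theta>\<in>{0<..<\<sigma>}. (\<lambda>k. \<i> * (\<i> * of_real \<theta>) ^ M * eval_fps g (of_real (\<rho> k) * exp (\<i> * of_real \<theta>)))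
      \<longlonglongrightarrow> \<i> * (\<i> * of_real \<theta>) ^ M * h \<theta>"
      using lim unfolding \<rho>_def by (intro ballI tendsto_intros) auto
    show "(\<lambda>k. circle_primitive M g (\<rho> k) (of_real \<sigma>) - circle_primitive M g (\<rho> k) (of_real 0)) \<longlonglongrightarrow>
      circle_primitive M g 1 (of_real \<sigma>) - circle_primitive M g 1 (of_real 0)"
      unfolding \<rho>_def by (intro tendsto_diff circle_primitive_tendsto assms)
  qed
  thus ?thesis by (simp add: has_integral_Icc_iff_Ioo)
qed

subsection \<open>The function A and the logarithm on the unit circle\<close>

text \<open>For 0 < \<theta> < 2 pi the number 1 - exp(\<i> \<theta>) has positive real part, so the
  principal branch gives the radial limit of Li_1.\<close>

definition Li1_circle :: "real \<Rightarrow> complex" where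
  "Li1_circle \<theta> = - Ln (1 - exp (\<i> * of_real \<theta>))"

lemma Acl_eq:
  assumes "0 < \<theta>" "\<theta> < 2 * pi"
  shows "Acl \<theta> = ln (2 * sin (\<theta> / 2))" "sin (\<theta> / 2) > 0"
proof -
  show "sin (\<theta> / 2) > 0" using assms by (intro sin_gt_zero) auto
  thus "Acl \<theta> = ln (2 * sin (\<theta> / 2))" by (simp add: Acl_def)
qed

text \<open>Polar form: the modulus is 2 sin(\<theta>/2) = exp A(\<theta>), and the argument
  (\<theta> - pi)/2 lies between -pi/2 and pi/2, where \<open>Ln\<close> inverts
  \<open>exp\<close>.\<close>

lemma one_minus_exp_eq:
  assumes "0 < \<theta>" "\<theta> < 2 * pi"
  shows "1 - exp (\<i> * of_real \<theta>) = exp (of_real (Acl \<theta>) + \<i> * of_real ((\<theta> - pi) / 2))"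
proof -
  define x where "x = \<theta> / 2"
  have th: "\<theta> = 2 * x" by (simp add: x_def)
  have "(\<theta> - pi) / 2 = x - pi / 2" by (simp add: x_def field_simps)
  moreover have "exp (Acl \<theta>) = 2 * sin x" using Acl_eq[OF assms] by (simp add: x_def)
  ultimately have "exp (of_real (Acl \<theta>) + \<i> * of_real ((\<theta> - pi) / 2)) = of_real (2 * sin x) * cis (x - pi / 2)"
    by (simp only: exp_add cis_conv_exp exp_of_real)
  also have "\<dots> = 1 - cis (2 * x)"
    by (rule complex_eqI)
      (simp_all add: cos_diff sin_diff cos_double_sin sin_double power2_eq_square)
  also have "\<dots> = 1 - exp (\<i> * of_real \<theta>)" by (simp add: cis_conv_exp th)
  finally show ?thesis by simp
qed

lemma Li1_circle_eq:
  assumes "0 < \<theta>" "\<theta> < 2 * pi"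
  shows "Li1_circle \<theta> = - of_real (Acl \<theta>) - \<i> * of_real \<theta> / 2 + \<i> * of_real pi / 2"
proof -
  have "Ln (1 - exp (\<i> * of_real \<theta>)) = of_real (Acl \<theta>) + \<i> * of_real ((\<theta> - pi) / 2)"
    unfolding one_minus_exp_eq[OF assms] using assms by (intro Ln_exp) auto
  thus ?thesis by (simp add: Li1_circle_def field_simps)
qed

lemma polylog_E1_nth: "polylog [E1] $ n = 1 / of_nat n"
proof (cases n)
  case (Suc m)
  have "(\<Sum>i<Suc m. (1 :: complex fps) $ i) = 1" by (induction m) auto
  thus ?thesis using Suc polylog_snoc_E1_nth[of "[]" n] by simp
qed simp

lemma eval_polylog_E1:
  assumes "norm z < 1"
  shows "eval_fps (polylog [E1]) z = - Ln (1 - z)"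
proof -
  have "(\<lambda>n. - (z ^ n) / of_nat n) sums Ln (1 - z)"
    using Ln_series'[of "- z"] assms by simp
  hence "(\<lambda>n. z ^ n / of_nat n) sums - Ln (1 - z)"
    using sums_minus by fastforce
  thus ?thesis by (simp add: eval_fps_def polylog_E1_nth sums_iff)
qed

text \<open>With e = exp(\<i> \<theta>), the modulus of w = 1 - \<rho> e lies between |1 - e| / 2
  and 2, since |1 - e| \<le> |w| + (1 - \<rho>) and 1 - \<rho> \<le> |w|. Hence A controls ln |w|
  uniformly in \<rho>, and pi bounds the argument.\<close>

lemma norm_Ln_one_minus_le:
  assumes "0 < \<theta>" "\<theta> < 2 * pi" "0 \<le> \<rho>" "\<rho> < 1"
  shows "norm (Ln (1 - of_real \<rho> * exp (\<i> * of_real \<theta>))) \<le> ln 2 + pi + \<bar>Acl \<theta>\<bar>"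
proof -
  let ?e = "exp (\<i> * complex_of_real \<theta>)"
  let ?w = "1 - of_real \<rho> * ?e"
  have ne: "norm (of_real \<rho> * ?e) = \<rho>" using assms by (simp add: norm_mult)
  have "1 - \<rho> \<le> norm ?w"
    using norm_triangle_ineq2[of 1 "of_real \<rho> * ?e"] ne by simp
  moreover have "norm (1 - ?e) \<le> norm ?w + norm (of_real (\<rho> - 1) * ?e)"
    by (rule order_trans[OF _ norm_triangle_ineq]) (simp add: algebra_simps)
  moreover have "norm (of_real (\<rho> - 1) * ?e) = 1 - \<rho>"
    using assms by (simp only: norm_mult norm_of_real) simp
  ultimately have "norm (1 - ?e) \<le> 2 * norm ?w" by linarith
  moreover have "norm (1 - ?e) = exp (Acl \<theta>)"
    unfolding one_minus_exp_eq[OF assms(1,2)] by simp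
  ultimately have lo: "exp (Acl \<theta>) \<le> 2 * norm ?w" by simp
  have w: "norm ?w > 0" using lo exp_gt_zero[of "Acl \<theta>"] by linarith
  have "norm ?w \<le> norm (1::complex) + norm (of_real \<rho> * ?e)" by (rule norm_triangle_ineq4)
  hence "norm ?w \<le> 2" using assms ne by simp
  hence "ln (norm ?w) \<le> ln 2" using w by simp
  moreover have "Acl \<theta> \<le> ln (2 * norm ?w)"
    using lo w by (subst ln_ge_iff) auto
  hence "Acl \<theta> \<le> ln 2 + ln (norm ?w)"
    using w by (simp add: ln_mult)
  ultimately have "\<bar>ln (norm ?w)\<bar> \<le> ln 2 + \<bar>Acl \<theta>\<bar>" by linarith
  moreover have "norm (Ln ?w) \<le> \<bar>Re (Ln ?w)\<bar> + \<bar>Im (Ln ?w)\<bar>" by (rule cmod_le)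
  moreover have "\<bar>Im (Ln ?w)\<bar> \<le> pi"
    using mpi_less_Im_Ln[of ?w] Im_Ln_le_pi[of ?w] w by auto
  moreover have "Re (Ln ?w) = ln (norm ?w)" using w by (intro Re_Ln) auto
  ultimately show ?thesis by linarith
qed

lemma Li1_circle_tendsto:
  assumes "0 < \<theta>" "\<theta> < 2 * pi"
  shows "(\<lambda>k. eval_fps (polylog [E1]) (of_real (1 - inverse (real (Suc k))) * exp (\<i> * of_real \<theta>)))
    \<longlonglongrightarrow> Li1_circle \<theta>"
proof -
  have "Re (1 - exp (\<i> * complex_of_real \<theta>)) = 1 - cos \<theta>" by (simp add: Re_exp)
  moreover have "cos \<theta> = 1 - 2 * (sin (\<theta> / 2))\<^sup>2"
    using cos_double_sin[of "\<theta> / 2"] by simp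
  ultimately have "Re (1 - exp (\<i> * complex_of_real \<theta>)) > 0"
    using Acl_eq(2)[OF assms] by simp
  hence nr: "1 - exp (\<i> * complex_of_real \<theta>) \<notin> \<real>\<^sub>\<le>\<^sub>0"
    by (auto simp: complex_nonpos_Reals_iff)
  have "(\<lambda>k. - Ln (1 - of_real (1 - inverse (real (Suc k))) * exp (\<i> * of_real \<theta>)))
    \<longlonglongrightarrow> - Ln (1 - of_real (1 - 0) * exp (\<i> * of_real \<theta>))"
    by (intro tendsto_intros LIMSEQ_inverse_real_of_nat) (use nr in simp)
  moreover have "eval_fps (polylog [E1]) (of_real (1 - inverse (real (Suc k))) * exp (\<i> * of_real \<theta>)) =
    - Ln (1 - of_real (1 - inverse (real (Suc k))) * exp (\<i> * of_real \<theta>))" for k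
  proof (rule eval_polylog_E1)
    have "\<bar>1 - inverse (real (Suc k))\<bar> < 1" by (simp add: field_simps)
    thus "norm (of_real (1 - inverse (real (Suc k))) * exp (\<i> * complex_of_real \<theta>)) < 1"
      by (simp only: norm_mult norm_of_real norm_exp_i_times mult_1_right)
  qed
  ultimately show ?thesis by (simp add: Li1_circle_def)
qed

section \<open>Integrability of powers of A\<close>

lemma sin_ge_quarter:
  assumes "0 \<le> x" "x \<le> pi / 2"
  shows "x / 4 \<le> sin x"
proof -
  have "concave_on {0..pi} sin"
    by (rule f''_le0_imp_concave[where f' = cos and f'' = "\<lambda>x. - sin x"])
      (auto intro!: derivative_eq_intros sin_ge_zero)
  \<comment> \<open>Jordan's inequality: the graph lies above its chord over 0 to pi / 2. The slope
    is then made rational by pi < 4.\<close>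
  from concave_onD[OF this, of "2 * x / pi" 0 "pi / 2"] assms have "2 * x / pi \<le> sin x"
    by (simp add: field_simps)
  moreover have "x * pi \<le> x * 4" using assms pi_less_4 by (intro mult_left_mono) auto
  hence "x / 4 \<le> 2 * x / pi" using assms by (simp add: field_simps)
  ultimately show ?thesis by linarith
qed

text \<open>A single term of the exponential series; it serves to absorb powers of a logarithm into
  a small power of the argument.\<close>

lemma power_le_fact_exp:
  assumes "0 \<le> (y::real)"
  shows "y ^ b \<le> fact b * exp y"
proof -
  have "(\<Sum>n\<in>{b}. y ^ n /\<^sub>R fact n) \<le> (\<Sum>n. y ^ n /\<^sub>R fact n)"
    using assms by (intro sum_le_suminf summable_exp_generic) auto
  hence "y ^ b / fact b \<le> exp y"
    by (simp add: exp_def divide_inverse mult.commute)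
  thus ?thesis by (simp add: field_simps)
qed

lemma Acl_power_bound:
  assumes "0 \<le> c"
  obtains C where "C \<ge> 0" "\<And>\<theta>. 0 < \<theta> \<Longrightarrow> \<theta> < 2 * pi \<Longrightarrow>
    (c + \<bar>Acl \<theta>\<bar>) ^ b \<le> C * (1 / sqrt \<theta> + 1 / sqrt (2 * pi - \<theta>))"
proof
  \<comment> \<open>Halving before the comparison with exp makes the logarithm cost only exp(|ln s|
    / 2), hence an integrable s^(-1/2); \<open>2 ^ b\<close> undoes the halving. The factor 4 of the
    witness comes from \<open>key\<close>.\<close>
  define K where "K = 2 ^ b * fact b * exp (c / 2)"
  show "4 * K \<ge> 0" by (simp add: K_def)
  fix \<theta> assume \<theta>: "0 < \<theta>" "\<theta> < 2 * pi"
  define s where "s = 2 * sin (\<theta> / 2)"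
  have s: "s > 0" "Acl \<theta> = ln s" "s \<le> 2" using Acl_eq[OF \<theta>] by (auto simp: s_def)
  \<comment> \<open>The left side is sqrt s or its inverse; the former is at most 2 / sqrt s because
    s \<le> 2.\<close>
  have e: "exp (\<bar>ln s\<bar> / 2) \<le> 2 / sqrt s"
  proof (cases "s \<le> 1")
    case True
    have "exp (\<bar>ln s\<bar> / 2) = exp (- ln (sqrt s))" using True s by (simp add: ln_sqrt)
    also have "\<dots> = 1 / sqrt s" using s by (simp add: exp_minus divide_inverse)
    also have "\<dots> \<le> 2 / sqrt s" using s by (intro divide_right_mono) auto
    finally show ?thesis .
  next
    case False
    have "exp (\<bar>ln s\<bar> / 2) = exp (ln (sqrt s))" using False s by (simp add: ln_sqrt)
    also have "\<dots> = sqrt s" using s by simp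
    also have "\<dots> = s / sqrt s" using s by (simp add: real_div_sqrt)
    also have "\<dots> \<le> 2 / sqrt s" using s by (intro divide_right_mono) auto
    finally show ?thesis .
  qed
  have "(c + \<bar>Acl \<theta>\<bar>) ^ b = 2 ^ b * ((c + \<bar>ln s\<bar>) / 2) ^ b"
    by (simp add: s power_divide)
  also have "\<dots> \<le> 2 ^ b * (fact b * exp ((c + \<bar>ln s\<bar>) / 2))"
    using assms by (intro mult_left_mono power_le_fact_exp) auto
  also have "\<dots> = K * exp (\<bar>ln s\<bar> / 2)"
    by (simp add: K_def add_divide_distrib exp_add)
  also have "\<dots> \<le> K * (2 / sqrt s)"
    by (intro mult_left_mono e) (simp add: K_def)
  also have "\<dots> \<le> K * (4 * (1 / sqrt \<theta> + 1 / sqrt (2 * pi - \<theta>)))"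
  proof (rule mult_left_mono)
    \<comment> \<open>Applied with \<open>x\<close> the distance from \<open>\<theta>\<close> to the
      nearer end of the interval from 0 to 2 pi.\<close>
    have key: "2 / sqrt s \<le> 4 * (1 / sqrt x)" if "x > 0" "x / 4 \<le> s" for x
    proof -
      have "sqrt x = sqrt (4 * (x / 4))" by simp
      also have "\<dots> = 2 * sqrt (x / 4)" by (subst real_sqrt_mult) simp
      also have "\<dots> \<le> 2 * sqrt s" using that by simp
      finally show ?thesis using that s by (simp add: field_simps)
    qed
    have pos: "1 / sqrt \<theta> \<ge> 0" "1 / sqrt (2 * pi - \<theta>) \<ge> 0" using \<theta> by auto
    show "2 / sqrt s \<le> 4 * (1 / sqrt \<theta> + 1 / sqrt (2 * pi - \<theta>))"
    proof (cases "\<theta> \<le> pi")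
      case True
      have "\<theta> / 2 / 4 \<le> sin (\<theta> / 2)" using True \<theta> by (intro sin_ge_quarter) auto
      hence "\<theta> / 4 \<le> s" by (simp add: s_def)
      have "2 / sqrt s \<le> 4 * (1 / sqrt \<theta>)" by (rule key) fact+
      also have "\<dots> \<le> 4 * (1 / sqrt \<theta> + 1 / sqrt (2 * pi - \<theta>))"
        using pos by (intro mult_left_mono) auto
      finally show ?thesis .
    next
      case False
      have "(pi - \<theta> / 2) / 4 \<le> sin (pi - \<theta> / 2)" using False \<theta> by (intro sin_ge_quarter) auto
      hence "(2 * pi - \<theta>) / 4 \<le> s" by (simp add: s_def)
      moreover have "2 * pi - \<theta> > 0" using \<theta> by simp
      ultimately have "2 / sqrt s \<le> 4 * (1 / sqrt (2 * pi - \<theta>))" by (intro key)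
      also have "\<dots> \<le> 4 * (1 / sqrt \<theta> + 1 / sqrt (2 * pi - \<theta>))"
        using pos by (intro mult_left_mono) auto
      finally show ?thesis .
    qed
    show "K \<ge> 0" by (simp add: K_def)
  qed
  finally show "(c + \<bar>Acl \<theta>\<bar>) ^ b \<le> 4 * K * (1 / sqrt \<theta> + 1 / sqrt (2 * pi - \<theta>))"
    by (simp only: mult.assoc mult.left_commute)
qed

lemma Acl_measurable [measurable]: "Acl \<in> borel_measurable borel"
  unfolding Acl_def[abs_def] by measurable

lemma Acl_power_integrable:
  assumes "0 \<le> c" "0 \<le> \<sigma>" "\<sigma> \<le> 2 * pi"
  shows "(\<lambda>\<theta>. (c + \<bar>Acl \<theta>\<bar>) ^ b) integrable_on {0..\<sigma>}"
proof -
  obtain C where C: "C \<ge> 0" "\<And>\<theta>. 0 < \<theta> \<Longrightarrow> \<theta> < 2 * pi \<Longrightarrow>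
    (c + \<bar>Acl \<theta>\<bar>) ^ b \<le> C * (1 / sqrt \<theta> + 1 / sqrt (2 * pi - \<theta>))"
    using Acl_power_bound[OF assms(1)] by blast
  \<comment> \<open>The primitive 2 C (sqrt \<theta> - sqrt (2 pi - \<theta>)) of the majorant is
    continuous up to both ends.\<close>
  have "((\<lambda>\<theta>. C * (1 / sqrt \<theta> + 1 / sqrt (2 * pi - \<theta>))) has_integral
      C * (2 * sqrt (2 * pi) - 2 * sqrt (2 * pi - 2 * pi)) -
      C * (2 * sqrt 0 - 2 * sqrt (2 * pi - 0))) {0..2 * pi}"
    by (rule fundamental_theorem_of_calculus_interior)
      (auto intro!: continuous_intros derivative_eq_intros
        simp: has_real_derivative_iff_has_vector_derivative[symmetric] field_simps)
  hence g: "(\<lambda>\<theta>. C * (1 / sqrt \<theta> + 1 / sqrt (2 * pi - \<theta>))) integrable_on {0<..<2 * pi}"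
    unfolding integrable_on_Icc_iff_Ioo[symmetric] by blast
  have "(\<lambda>\<theta>. (c + \<bar>Acl \<theta>\<bar>) ^ b) integrable_on {0<..<2 * pi}"
  proof (rule measurable_bounded_by_integrable_imp_integrable[OF _ g])
    have "(\<lambda>\<theta>. (c + \<bar>Acl \<theta>\<bar>) ^ b) \<in> borel_measurable borel" by measurable
    hence "(\<lambda>\<theta>. (c + \<bar>Acl \<theta>\<bar>) ^ b) \<in> borel_measurable lebesgue"
      by (intro measurable_completion) simp
    thus "(\<lambda>\<theta>. (c + \<bar>Acl \<theta>\<bar>) ^ b) \<in> borel_measurable (lebesgue_on {0<..<2 * pi})"
      by (rule measurable_restrict_space1)
  qed (use C(2) assms in auto)
  hence "(\<lambda>\<theta>. (c + \<bar>Acl \<theta>\<bar>) ^ b) integrable_on {0..2 * pi}"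
    by (simp add: integrable_on_Icc_iff_Ioo)
  thus ?thesis by (rule integrable_on_subinterval) (use assms in auto)
qed

text \<open>\<open>Ls\<close> is built from Lebesgue integrals, while primitives are handled by
  gauge integrals; this integrability is the bridge between them.\<close>

lemma Acl_set_integrable:
  fixes h :: "real \<Rightarrow> real"
  assumes "continuous_on {0..\<sigma>} h" "0 \<le> \<sigma>" "\<sigma> \<le> 2 * pi"
  shows "set_integrable lborel {0..\<sigma>} (\<lambda>\<theta>. \<theta> ^ l * Acl \<theta> ^ m * h \<theta>)"
proof -
  obtain B where B: "B \<ge> 0" "\<And>\<theta>. \<theta> \<in> {0..\<sigma>} \<Longrightarrow> norm (h \<theta>) \<le> B"
  proof -
    have "bounded (h ` {0..\<sigma>})"
      using assms by (intro compact_imp_bounded compact_continuous_image) auto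
    then obtain b where "b > 0" "\<forall>x\<in>{0..\<sigma>}. norm (h x) \<le> b" by (auto simp: bounded_pos)
    thus ?thesis using that[of b] by auto
  qed
  have meas: "(\<lambda>\<theta>. indicator {0..\<sigma>} \<theta> *\<^sub>R (\<theta> ^ l * Acl \<theta> ^ m * h \<theta>)) \<in> borel_measurable borel"
  proof -
    have "(\<lambda>\<theta>. indicator {0..\<sigma>} \<theta> *\<^sub>R h \<theta>) \<in> borel_measurable borel"
      using assms(1) by (intro borel_measurable_continuous_on_indicator) auto
    hence "(\<lambda>\<theta>. \<theta> ^ l * Acl \<theta> ^ m * (indicator {0..\<sigma>} \<theta> *\<^sub>R h \<theta>)) \<in> borel_measurable borel"
      by measurable
    thus ?thesis by (simp add: mult_ac)
  qed
  let ?D = "\<lambda>\<theta>. \<sigma> ^ l * B * (0 + \<bar>Acl \<theta>\<bar>) ^ m"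
  have D: "?D integrable_on {0..\<sigma>}"
    by (intro integrable_on_mult_right Acl_power_integrable) (use assms in auto)
  have "?D absolutely_integrable_on {0..\<sigma>}"
    using D B assms(2) by (intro nonnegative_absolutely_integrable_1) auto
  hence "integrable lebesgue (\<lambda>\<theta>. indicator {0..\<sigma>} \<theta> *\<^sub>R ?D \<theta>)"
    by (simp add: set_integrable_def)
  hence "integrable lborel (\<lambda>\<theta>. indicator {0..\<sigma>} \<theta> *\<^sub>R ?D \<theta>)"
    by (subst (asm) integrable_completion) auto
  hence "integrable lborel (\<lambda>\<theta>. indicator {0..\<sigma>} \<theta> *\<^sub>R (\<theta> ^ l * Acl \<theta> ^ m * h \<theta>))"
  proof (rule Bochner_Integration.integrable_bound)
    show "AE \<theta> in lborel. norm (indicator {0..\<sigma>} \<theta> *\<^sub>R (\<theta> ^ l * Acl \<theta> ^ m * h \<theta>))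
        \<le> norm (indicator {0..\<sigma>} \<theta> *\<^sub>R ?D \<theta>)"
    proof (rule AE_I2)
      fix \<theta> :: real
      have "\<bar>\<theta>\<bar> ^ l * \<bar>Acl \<theta>\<bar> ^ m * \<bar>h \<theta>\<bar> \<le> \<bar>\<sigma>\<bar> ^ l * \<bar>Acl \<theta>\<bar> ^ m * \<bar>B\<bar>" if "\<theta> \<in> {0..\<sigma>}"
        using that B(1) B(2)[OF that] by (intro mult_mono power_mono) auto
      thus "norm (indicator {0..\<sigma>} \<theta> *\<^sub>R (\<theta> ^ l * Acl \<theta> ^ m * h \<theta>))
        \<le> norm (indicator {0..\<sigma>} \<theta> *\<^sub>R ?D \<theta>)"
        by (auto simp: indicator_def abs_mult power_abs mult_ac)
    qed
  qed (use meas in simp)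
  thus ?thesis by (simp add: set_integrable_def)
qed

subsection \<open>The functions f\<close>

definition zero_prefix :: "nat list \<Rightarrow> nat" where
  "zero_prefix r = length (takeWhile (\<lambda>x. x = 0) r)"

text \<open>The added \<open>sum_list (take n q) + n\<close> is the exponent of
  \<open>\<i> * \<theta>\<close> accumulated by the leading components with vanishing
  \<open>r\<close>, which gain 1 at each integration.\<close>

definition qbar :: "nat list \<Rightarrow> nat list \<Rightarrow> nat list" where
  "qbar q r = (let n = zero_prefix r in if drop n q = [] then []
    else (sum_list (take n q) + n + hd (drop n q)) # tl (drop n q))"

lemma f_fun_eq:
  "f_fun q r \<sigma> = Bc (take (zero_prefix r) q) * (\<Sum>j\<in>{j. prec j (qbar q r)}.
     Cc (qbar q r) j * (\<i> * of_real \<sigma>) ^ (sum_list q + zero_prefix r - sum_list j)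
       * Lpoly (wjr j (drop (zero_prefix r) r)) (exp (\<i> * of_real \<sigma>)))"
  by (simp add: f_fun_def qbar_def zero_prefix_def Let_def)

lemma zero_prefix_le: "zero_prefix r \<le> length r"
  by (simp add: zero_prefix_def length_takeWhile_le)

lemma hd_drop_zero_prefix: "drop (zero_prefix r) r \<noteq> [] \<Longrightarrow> hd (drop (zero_prefix r) r) > 0"
  unfolding zero_prefix_def using hd_dropWhile[of "\<lambda>x. x = 0" r]
  by (simp add: dropWhile_eq_drop[symmetric])

lemma length_qbar:
  "length q = length r \<Longrightarrow> length (qbar q r) = length (drop (zero_prefix r) r)"
  by (auto simp: qbar_def Let_def)

lemma sum_list_qbar:
  assumes "length q = length r"
  shows "sum_list (qbar q r) = (if drop (zero_prefix r) r = [] then 0 else sum_list q + zero_prefix r)"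
proof (cases "drop (zero_prefix r) q = []")
  case True
  thus ?thesis using assms by (simp add: qbar_def)
next
  case False
  have "sum_list q = sum_list (take (zero_prefix r) q) + sum_list (drop (zero_prefix r) q)"
    by (metis append_take_drop_id sum_list_append)
  also have "sum_list (drop (zero_prefix r) q) =
      hd (drop (zero_prefix r) q) + sum_list (tl (drop (zero_prefix r) q))"
    using False by (cases "drop (zero_prefix r) q") auto
  finally show ?thesis using False assms by (simp add: qbar_def Let_def)
qed

text \<open>The number \<open>x\<close> is \<open>a\<close> unless \<open>r\<close> vanishes identically; then it absorbs all of \<open>q\<close>.\<close>
lemma qbar_snoc:
  assumes "length q = length r" "drop (zero_prefix r) r \<noteq> [] \<or> b > 0"
  shows "zero_prefix (r @ [b]) = zero_prefix r"
    and "\<exists>x. qbar (q @ [a]) (r @ [b]) = qbar q r @ [x] \<and>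
      sum_list (qbar q r) + x = sum_list q + zero_prefix r + a"
proof -
  have dw: "drop (zero_prefix r) r = dropWhile (\<lambda>x. x = 0) r"
    by (simp add: zero_prefix_def dropWhile_eq_drop)
  show z: "zero_prefix (r @ [b]) = zero_prefix r"
  proof (cases "drop (zero_prefix r) r = []")
    case True
    hence "\<forall>x\<in>set r. x = 0" by (simp add: dw)
    hence "takeWhile (\<lambda>x. x = 0) (r @ [b]) = r" "takeWhile (\<lambda>x. x = 0) r = r"
      using assms True by (simp_all add: takeWhile_append2)
    thus ?thesis by (simp only: zero_prefix_def)
  next
    case False
    hence "\<not> (\<forall>x\<in>set r. x = 0)" by (simp add: dw)
    thus ?thesis by (auto simp: zero_prefix_def takeWhile_append1)
  qed
  show "\<exists>x. qbar (q @ [a]) (r @ [b]) = qbar q r @ [x] \<and>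
      sum_list (qbar q r) + x = sum_list q + zero_prefix r + a"
  proof (cases "drop (zero_prefix r) r = []")
    case True
    thus ?thesis using assms(1) zero_prefix_le[of r] by (simp add: qbar_def z Let_def)
  next
    case False
    hence "drop (zero_prefix r) q \<noteq> []" using assms(1) by simp
    hence "qbar (q @ [a]) (r @ [b]) = qbar q r @ [a]"
      using assms(1) by (auto simp: qbar_def z Let_def)
    moreover have "sum_list (qbar q r) = sum_list q + zero_prefix r"
      using sum_list_qbar[OF assms(1)] False by simp
    ultimately show ?thesis by simp
  qed
qed

section \<open>Summation over the admissible tuples j\<close>

lemma prec_snoc:
  "prec (j @ [t]) (q @ [x]) \<longleftrightarrow> prec j q \<and> sum_list j + t \<le> sum_list q + x"
proof (cases "length j = length q")
  case True
  have "(\<forall>s\<le>Suc (length q). R s) \<longleftrightarrow> (\<forall>s\<le>length q. R s) \<and> R (Suc (length q))" for R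
    by (auto simp: le_Suc_eq)
  thus ?thesis using True by (simp add: prec_def cong: conj_cong)
qed (simp add: prec_def)

lemma prec_sum_list: "prec j q \<Longrightarrow> sum_list j \<le> sum_list q"
  by (auto simp: prec_def dest: spec[of _ "length q"])

lemma finite_prec: "finite {j. prec j q}"
proof (rule finite_subset)
  show "{j. prec j q} \<subseteq> {j. set j \<subseteq> {..sum_list q} \<and> length j = length q}"
  proof
    fix j assume j: "j \<in> {j. prec j q}"
    hence "t \<le> sum_list q" if "t \<in> set j" for t
      using prec_sum_list[of j q] member_le_sum_list[OF that] by simp
    thus "j \<in> {j. set j \<subseteq> {..sum_list q} \<and> length j = length q}"
      using j by (auto simp: prec_def)
  qed
  show "finite {j. set j \<subseteq> {..sum_list q} \<and> length j = length q}"
    by (rule finite_lists_length_eq) simp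
qed

text \<open>The bound on \<open>t\<close> is the degree left over by \<open>j\<close>, so the inner
  sum runs over the steps of one further integration by parts, as in
  \<open>circle_primitive\<close>.\<close>

lemma sum_prec_snoc:
  "(\<Sum>j\<in>{j. prec j (q @ [x])}. \<phi> j) =
   (\<Sum>j\<in>{j. prec j q}. \<Sum>t\<le>sum_list q + x - sum_list j. \<phi> (j @ [t]))"
proof -
  have "(\<Sum>j\<in>{j. prec j q}. \<Sum>t\<le>sum_list q + x - sum_list j. \<phi> (j @ [t])) =
    (\<Sum>(j, t)\<in>(SIGMA j:{j. prec j q}. {..sum_list q + x - sum_list j}). \<phi> (j @ [t]))"
    by (rule sum.Sigma) (auto intro: finite_prec)
  also have "\<dots> = (\<Sum>j\<in>{j. prec j (q @ [x])}. \<phi> j)"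
  proof (rule sum.reindex_bij_witness[of _ "\<lambda>j. (butlast j, last j)" "\<lambda>(j, t). j @ [t]"])
    fix j assume "j \<in> {j. prec j (q @ [x])}"
    moreover from this obtain j' t where "j = j' @ [t]"
      by (cases j rule: rev_cases) (auto simp: prec_def)
    ultimately show "(case (butlast j, last j) of (j, t) \<Rightarrow> j @ [t]) = j"
      "(butlast j, last j) \<in> (SIGMA j:{j. prec j q}. {..sum_list q + x - sum_list j})"
      by (auto simp: prec_snoc)
  next
    fix p assume "p \<in> (SIGMA j:{j. prec j q}. {..sum_list q + x - sum_list j})"
    thus "(case p of (j, t) \<Rightarrow> j @ [t]) \<in> {j. prec j (q @ [x])}"
      using prec_sum_list[of "fst p" q] by (auto simp: prec_snoc)
  qed auto
  finally show ?thesis ..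
qed

lemma Cc_snoc:
  "Cc (q @ [x]) (j @ [t]) = (-1) ^ t * (fact (sum_list q + x - sum_list j) /
    fact (sum_list q + x - sum_list j - t)) * Cc q j"
  by (simp add: Cc_def sum_list_rev add.commute[of x] add.commute[of t])

lemma wjr_words:
  assumes "length j = length s" "s \<noteq> [] \<Longrightarrow> hd s > 0" "(c, u) \<in> set (wjr j s)"
  shows "admissible u \<and> summable (\<lambda>n. norm (polylog u $ n))"
proof (cases "s = []")
  case True
  hence "u = []" using assms by (simp add: wjr_def)
  moreover have "summable (\<lambda>n. norm ((1 :: complex fps) $ n))"
    by (rule summable_finite[of "{0}"]) auto
  ultimately show ?thesis by (simp add: admissible_def)
next
  case False
  thus ?thesis
    using wrev_words[of "rev j" "rev s" c u] summable_polylog_snoc_E0 assms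
    by (auto simp: wjr_def last_rev)
qed

lemma
  assumes "length j = length s" "s \<noteq> [] \<Longrightarrow> hd s > 0"
  shows summable_polylog_sum_wjr: "summable (\<lambda>n. norm (polylog_sum (wjr j s) $ n))"
    and Lpoly_wjr: "norm z \<le> 1 \<Longrightarrow> Lpoly (wjr j s) z = eval_fps (polylog_sum (wjr j s)) z"
proof -
  have "summable (\<lambda>n. norm (polylog_sum (wjr j s) $ n)) \<and>
    (\<forall>z. norm z \<le> 1 \<longrightarrow> Lpoly (wjr j s) z = eval_fps (polylog_sum (wjr j s)) z)"
    by (rule Lpoly_eq_eval_fps) (rule wjr_words[OF assms])
  thus "summable (\<lambda>n. norm (polylog_sum (wjr j s) $ n))"
    "norm z \<le> 1 \<Longrightarrow> Lpoly (wjr j s) z = eval_fps (polylog_sum (wjr j s)) z" by blast+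
qed

lemma polylog_sum_wjr_snoc:
  assumes "length j = length s" "s \<noteq> [] \<Longrightarrow> hd s > 0"
  shows "polylog_sum (wjr (j @ [t]) (s @ [b])) =
    (euler_int ^^ Suc t) (polylog_sum (wjr j s) * polylog [E1] ^ b)"
  unfolding wjr_def rev_append rev.simps append.simps
  by (rule polylog_sum_wrev_Cons) (use assms in \<open>auto simp: last_rev\<close>)

lemma polylog_sum_wjr_nth_0:
  assumes "length j = length s" "s \<noteq> []" "hd s > 0"
  shows "polylog_sum (wjr j s) $ 0 = 0"
proof -
  obtain j' t s' b where js: "j = j' @ [t]" "s = s' @ [b]"
    using assms by (metis length_0_conv rev_exhaust)
  have "s' \<noteq> [] \<Longrightarrow> hd s' > 0" using assms js by auto
  thus ?thesis using assms js by (simp add: polylog_sum_wjr_snoc)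
qed

lemma continuous_on_f_fun:
  assumes "length q = length r"
  shows "continuous_on A (f_fun q r)"
proof -
  have "continuous_on A (\<lambda>\<sigma>. Lpoly (wjr j (drop (zero_prefix r) r)) (exp (\<i> * of_real \<sigma>)))"
    if "prec j (qbar q r)" for j
  proof -
    have l: "length j = length (drop (zero_prefix r) r)"
      using that length_qbar[OF assms] by (simp add: prec_def)
    have "continuous_on A (\<lambda>\<sigma>. eval_fps (polylog_sum (wjr j (drop (zero_prefix r) r))) (exp (\<i> * of_real \<sigma>)))"
      by (rule continuous_on_compose2[OF continuous_on_eval_fps_cball[OF summable_polylog_sum_wjr[OF l]]])
        (auto intro!: continuous_intros hd_drop_zero_prefix)
    thus ?thesis using Lpoly_wjr[OF l hd_drop_zero_prefix] by simp
  qed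
  thus ?thesis unfolding f_fun_eq[abs_def] by (intro continuous_intros) auto
qed

text \<open>One factor of the integrand is an absolutely convergent, hence bounded, series; the
  other is a power of Li_1, dominated through |A|. The condition
  \<open>s \<noteq> [] \<or> b > 0\<close> ensures the zero constant term that Euler integration
  needs.\<close>

lemma has_integral_circle_Li1:
  assumes "length j = length s" "s \<noteq> [] \<Longrightarrow> hd s > 0" "s \<noteq> [] \<or> b > 0"
    and "0 \<le> \<sigma>" "\<sigma> \<le> 2 * pi"
  shows "((\<lambda>\<theta>. \<i> * (\<i> * of_real \<theta>) ^ M * (Lpoly (wjr j s) (exp (\<i> * of_real \<theta>)) * Li1_circle \<theta> ^ b)) has_integral
    circle_primitive M (polylog_sum (wjr j s) * polylog [E1] ^ b) 1 (of_real \<sigma>) -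
    circle_primitive M (polylog_sum (wjr j s) * polylog [E1] ^ b) 1 0) {0..\<sigma>}"
proof -
  define V where "V = polylog_sum (wjr j s)"
  have sV: "summable (\<lambda>n. norm (V $ n))"
    unfolding V_def by (rule summable_polylog_sum_wjr) (use assms in auto)
  have rad: "fps_conv_radius V \<ge> 1" by (rule fps_conv_radius_ge_1[OF sV])
  have rad1: "fps_conv_radius (polylog [E1]) \<ge> 1"
    unfolding fps_conv_radius_def
    by (rule conv_radius_ge_1_of_bounded[of _ 1]) (auto simp: polylog_E1_nth norm_divide divide_simps)
  have eval: "eval_fps (V * polylog [E1] ^ b) z = eval_fps V z * eval_fps (polylog [E1]) z ^ b"
    if "norm z < 1" for z
  proof -
    have z: "ereal (norm z) < 1" using that by simp
    note * = order_less_le_trans[OF z rad] order_less_le_trans[OF z rad1]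
      order_less_le_trans[OF z order_trans[OF rad1 fps_conv_radius_power]]
    show ?thesis using * by (simp add: eval_fps_mult eval_fps_power)
  qed
  have \<rho>1: "norm (of_real \<rho> * exp (\<i> * complex_of_real \<theta>)) < 1" if "0 \<le> \<rho>" "\<rho> < 1" for \<rho> \<theta>
    using that by (simp add: norm_mult)
  have g0: "(V * polylog [E1] ^ b) $ 0 = 0"
  proof (cases "s = []")
    case True
    thus ?thesis using assms(3) by (simp add: fps_power_zeroth)
  next
    case False
    thus ?thesis using polylog_sum_wjr_nth_0[OF assms(1)] assms(2) by (simp add: V_def)
  qed
  \<comment> \<open>After one Euler integration the series is that of the index extended by a
    component with j = 0; its words end in \<open>E0\<close>, whence summability.\<close>
  have "polylog_sum (wjr (j @ [0]) (s @ [b])) = euler_int (V * polylog [E1] ^ b)"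
    using polylog_sum_wjr_snoc[OF assms(1,2), of 0 b] by (simp add: V_def)
  moreover have "hd (s @ [b]) > 0" using assms(2,3) by (cases s) auto
  ultimately have sg: "summable (\<lambda>n. norm (euler_int (V * polylog [E1] ^ b) $ n))"
    using summable_polylog_sum_wjr[of "j @ [0]" "s @ [b]"] assms(1) by simp
  define K where "K = (\<Sum>n. norm (V $ n))"
  have "((\<lambda>\<theta>. \<i> * (\<i> * of_real \<theta>) ^ M * (eval_fps V (exp (\<i> * of_real \<theta>)) * Li1_circle \<theta> ^ b)) has_integral
    circle_primitive M (V * polylog [E1] ^ b) 1 (of_real \<sigma>) -
    circle_primitive M (V * polylog [E1] ^ b) 1 0) {0..\<sigma>}"
  proof (rule has_integral_circle_primitive[OF g0 sg assms(4)])
    show "(\<lambda>\<theta>. K * ((ln 2 + pi) + \<bar>Acl \<theta>\<bar>) ^ b) integrable_on {0..\<sigma>}"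
      using assms(4,5) by (intro integrable_on_mult_right Acl_power_integrable) auto
  next
    fix \<rho> \<theta> :: real assume \<rho>: "0 \<le> \<rho>" "\<rho> < 1" and \<theta>: "0 < \<theta>" "\<theta> < \<sigma>"
    let ?z = "of_real \<rho> * exp (\<i> * of_real \<theta>)"
    have "norm (eval_fps V ?z) \<le> K"
      unfolding K_def using \<rho>1[OF \<rho>, of \<theta>] by (intro norm_eval_fps_le[OF sV]) simp
    moreover have "norm (eval_fps (polylog [E1]) ?z) \<le> (ln 2 + pi) + \<bar>Acl \<theta>\<bar>"
      using norm_Ln_one_minus_le[of \<theta> \<rho>] \<rho> \<theta> assms(5) by (simp add: eval_polylog_E1 \<rho>1)
    ultimately show "norm (eval_fps (V * polylog [E1] ^ b) ?z) \<le> K * ((ln 2 + pi) + \<bar>Acl \<theta>\<bar>) ^ b"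
      unfolding eval[OF \<rho>1[OF \<rho>]] norm_mult norm_power
      by (intro mult_mono power_mono) (auto intro: order_trans[OF norm_ge_zero])
  next
    fix \<theta> :: real assume \<theta>: "0 < \<theta>" "\<theta> < \<sigma>"
    let ?z = "\<lambda>k. of_real (1 - inverse (real (Suc k))) * exp (\<i> * complex_of_real \<theta>)"
    have z1: "norm (?z k) < 1" for k
      by (rule \<rho>1) (auto simp: field_simps)
    have "?z \<longlonglongrightarrow> of_real (1 - 0) * exp (\<i> * of_real \<theta>)"
      by (intro tendsto_intros LIMSEQ_inverse_real_of_nat)
    hence "(\<lambda>k. eval_fps V (?z k)) \<longlonglongrightarrow> eval_fps V (exp (\<i> * of_real \<theta>))"
      by (intro continuous_on_tendsto_compose[OF continuous_on_eval_fps_cball[OF sV]])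
        (use z1 in \<open>auto simp: less_imp_le\<close>)
    moreover have "(\<lambda>k. eval_fps (polylog [E1]) (?z k)) \<longlonglongrightarrow> Li1_circle \<theta>"
      using \<theta> assms(5) by (intro Li1_circle_tendsto) auto
    ultimately show "(\<lambda>k. eval_fps (V * polylog [E1] ^ b) (?z k)) \<longlonglongrightarrow>
        eval_fps V (exp (\<i> * of_real \<theta>)) * Li1_circle \<theta> ^ b"
      unfolding eval[OF z1] by (intro tendsto_intros)
  qed
  thus ?thesis using Lpoly_wjr[OF assms(1,2)] by (simp add: V_def)
qed

lemma Bc_snoc: "Bc (q @ [a]) = Bc q / of_nat (sum_list q + a + length q + 1)"
  by (simp add: Bc_def sum_list_rev add_ac)

lemma f_fun_zeros:
  assumes "length q = length r" "drop (zero_prefix r) r = []"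
  shows "f_fun q r \<sigma> = Bc q * (\<i> * of_real \<sigma>) ^ (sum_list q + length q)"
proof -
  have z: "zero_prefix r = length q" using assms zero_prefix_le[of r] by simp
  have "{j. prec j []} = {[]}" by (auto simp: prec_def)
  moreover have "qbar q r = []" using length_qbar[OF assms(1)] assms(2) by simp
  ultimately show ?thesis using assms
    by (simp add: f_fun_eq z Cc_def wjr_def Lpoly_def Li_def word_index_def)
qed

text \<open>If \<open>r @ [b]\<close> vanishes throughout, the series part of the integrand is 1,
  whose constant term \<open>euler_int\<close> cannot integrate; the primitive is then a monomial
  with coefficient \<open>Bc\<close>. Otherwise each \<open>j\<close> contributes one
  \<open>circle_primitive\<close>.\<close>

lemma has_integral_f_fun_snoc:
  assumes "length q = length r" "0 \<le> \<sigma>" "\<sigma> \<le> 2 * pi"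
  shows "((\<lambda>\<theta>. \<i> * (\<i> * of_real \<theta>) ^ a * Li1_circle \<theta> ^ b * f_fun q r \<theta>) has_integral
    f_fun (q @ [a]) (r @ [b]) \<sigma> - f_fun (q @ [a]) (r @ [b]) 0) {0..\<sigma>}"
proof (cases "drop (zero_prefix r) r = [] \<and> b = 0")
  case True
  hence "\<forall>x\<in>set r. x = 0" by (simp add: zero_prefix_def flip: dropWhile_eq_drop)
  hence z: "drop (zero_prefix (r @ [b])) (r @ [b]) = []"
    using True by (simp add: zero_prefix_def takeWhile_append2 flip: dropWhile_eq_drop)
  define N where "N = sum_list q + a + length q"
  have f: "f_fun (q @ [a]) (r @ [b]) s = Bc q / of_nat (Suc N) * (\<i> * of_real s) ^ Suc N" for s
    using f_fun_zeros[OF _ z, of "q @ [a]" s] assms(1) by (simp add: Bc_snoc N_def)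
  have g: "\<i> * (\<i> * of_real s) ^ a * Li1_circle s ^ b * f_fun q r s = \<i> * Bc q * (\<i> * of_real s) ^ N" for s
    using f_fun_zeros[OF assms(1)] True by (simp add: N_def power_add mult_ac)
  have "((\<lambda>w. Bc q / of_nat (Suc N) * (\<i> * w) ^ Suc N) has_field_derivative
    \<i> * Bc q * (\<i> * w) ^ N) (at w)" for w
    by (auto intro!: derivative_eq_intros simp del: of_nat_Suc power_Suc)
  hence "((\<lambda>\<theta>. \<i> * Bc q * (\<i> * of_real \<theta>) ^ N) has_integral
    Bc q / of_nat (Suc N) * (\<i> * of_real \<sigma>) ^ Suc N - Bc q / of_nat (Suc N) * (\<i> * of_real 0) ^ Suc N) {0..\<sigma>}"
    using assms(2) by (intro fundamental_theorem_of_calculus has_vector_derivative_real_field)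
  thus ?thesis unfolding f g .
next
  case False
  define n s Q where "n = zero_prefix r" and "s = drop n r" and "Q = qbar q r"
  \<comment> \<open>The exponent of \<open>\<i> * \<theta>\<close> left over by \<open>j\<close>
    once the new factor is included; it also bounds the new last entry.\<close>
  define M where "M = (\<lambda>j. sum_list q + n + a - sum_list j)"
  define P where "P = (\<lambda>j. circle_primitive (M j) (polylog_sum (wjr j s) * polylog [E1] ^ b) 1)"
  have sb: "s \<noteq> [] \<or> b > 0" using False by (simp add: s_def n_def)
  have s: "s \<noteq> [] \<Longrightarrow> hd s > 0" using hd_drop_zero_prefix by (simp add: s_def n_def)
  have n: "n \<le> length r" using zero_prefix_le by (simp add: n_def)
  have zs: "zero_prefix (r @ [b]) = n"
    using qbar_snoc(1)[OF assms(1)] sb by (simp add: s_def n_def)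
  obtain x where x: "qbar (q @ [a]) (r @ [b]) = Q @ [x]" "sum_list Q + x = sum_list q + n + a"
    using qbar_snoc(2)[OF assms(1), of b a] sb by (auto simp: s_def n_def Q_def)
  have lj: "length j = length s" if "prec j Q" for j
    using that length_qbar[OF assms(1)] by (simp add: prec_def Q_def s_def n_def)
  \<comment> \<open>Admissibility of \<open>j\<close> makes the natural subtraction exact, so the
    exponent \<open>a\<close> can be split off.\<close>
  have Mj: "M j = a + (sum_list q + n - sum_list j)" if "prec j Q" for j
  proof -
    have "sum_list Q \<le> sum_list q + n"
      by (simp add: Q_def n_def sum_list_qbar[OF assms(1)])
    hence "sum_list j \<le> sum_list q + n" by (rule order_trans[OF prec_sum_list[OF that]])
    thus ?thesis by (simp add: M_def)
  qed
  have f: "f_fun (q @ [a]) (r @ [b]) t = Bc (take n q) * (\<Sum>j\<in>{j. prec j Q}. Cc Q j * P j (of_real t))" for t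
  proof -
    have "f_fun (q @ [a]) (r @ [b]) t = Bc (take n q) * (\<Sum>j\<in>{j. prec j Q}. \<Sum>u\<le>M j.
        Cc (Q @ [x]) (j @ [u]) * (\<i> * of_real t) ^ (M j - u) *
        Lpoly (wjr (j @ [u]) (s @ [b])) (exp (\<i> * of_real t)))"
    proof -
      have "sum_list (q @ [a]) + n - sum_list (j @ [u]) = M j - u" for j u
        by (simp add: M_def)
      moreover have "sum_list q + n + a - sum_list j = M j" for j by (simp add: M_def)
      ultimately show ?thesis
        unfolding f_fun_eq[of "q @ [a]"] zs x(1) sum_prec_snoc x(2)
        using n assms(1) by (simp add: s_def)
    qed
    also have "(\<Sum>j\<in>{j. prec j Q}. \<Sum>u\<le>M j.
        Cc (Q @ [x]) (j @ [u]) * (\<i> * of_real t) ^ (M j - u) *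
        Lpoly (wjr (j @ [u]) (s @ [b])) (exp (\<i> * of_real t))) =
        (\<Sum>j\<in>{j. prec j Q}. Cc Q j * P j (of_real t))"
    proof (rule sum.cong[OF refl])
      fix j assume "j \<in> {j. prec j Q}"
      hence j: "length j = length s" using lj by simp
      have hd: "hd (s @ [b]) > 0" using s sb by (cases s) auto
      have L: "Lpoly (wjr (j @ [u]) (s @ [b])) (exp (\<i> * of_real t)) =
        eval_fps ((euler_int ^^ Suc u) (polylog_sum (wjr j s) * polylog [E1] ^ b)) (exp (\<i> * of_real t))" for u
        using Lpoly_wjr[of "j @ [u]" "s @ [b]" "exp (\<i> * of_real t)"] hd j
          polylog_sum_wjr_snoc[OF j s, of u b] by simp
      show "(\<Sum>u\<le>M j. Cc (Q @ [x]) (j @ [u]) * (\<i> * of_real t) ^ (M j - u) *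
        Lpoly (wjr (j @ [u]) (s @ [b])) (exp (\<i> * of_real t))) = Cc Q j * P j (of_real t)"
        unfolding P_def circle_primitive_def L Cc_snoc x(2) M_def[symmetric] sum_distrib_left
        by (intro sum.cong refl) (simp add: M_def)
    qed
    finally show ?thesis .
  qed
  have "((\<lambda>\<theta>. Bc (take n q) * (\<Sum>j\<in>{j. prec j Q}. Cc Q j *
      (\<i> * (\<i> * of_real \<theta>) ^ M j * (Lpoly (wjr j s) (exp (\<i> * of_real \<theta>)) * Li1_circle \<theta> ^ b)))) has_integral
      Bc (take n q) * (\<Sum>j\<in>{j. prec j Q}. Cc Q j * (P j (of_real \<sigma>) - P j 0))) {0..\<sigma>}"
    unfolding P_def using lj s sb assms(2,3)
    by (intro has_integral_mult_right has_integral_sum finite_prec has_integral_circle_Li1) auto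
  moreover have "Bc (take n q) * (\<Sum>j\<in>{j. prec j Q}. Cc Q j *
      (\<i> * (\<i> * of_real \<theta>) ^ M j * (Lpoly (wjr j s) (exp (\<i> * of_real \<theta>)) * Li1_circle \<theta> ^ b))) =
      \<i> * (\<i> * of_real \<theta>) ^ a * Li1_circle \<theta> ^ b * f_fun q r \<theta>" for \<theta>
    unfolding f_fun_eq n_def[symmetric] s_def[symmetric] Q_def[symmetric] sum_distrib_left
    by (intro sum.cong refl) (simp add: Mj power_add mult_ac)
  moreover have "Bc (take n q) * (\<Sum>j\<in>{j. prec j Q}. Cc Q j * (P j (of_real \<sigma>) - P j 0)) =
      f_fun (q @ [a]) (r @ [b]) \<sigma> - f_fun (q @ [a]) (r @ [b]) 0"
    by (simp add: f right_diff_distrib sum_subtractf)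
  ultimately show ?thesis by simp
qed

subsection \<open>The functions F\<close>

lemma comps_0: "comps 0 = {[]}"
proof -
  have "c = []" if "\<forall>x\<in>set c. 0 < x" "\<forall>x\<in>set c. x = 0" for c :: "nat list"
    using that by (cases c) auto
  thus ?thesis by (auto simp: comps_def)
qed

text \<open>The last part of a composition of n + 1 is either 1, and can be removed, or larger, and
  can be lowered by 1. The empty composition has no last part to raise.\<close>

lemma comps_Suc:
  "comps (Suc n) = (\<lambda>c. c @ [1]) ` comps n \<union> (\<lambda>c. butlast c @ [Suc (last c)]) ` (comps n - {[]})"
  (is "_ = ?A \<union> ?B")
proof (intro equalityI subsetI)
  fix c assume c: "c \<in> comps (Suc n)"
  then obtain d x where d: "c = d @ [x]" by (cases c rule: rev_cases) (auto simp: comps_def)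
  show "c \<in> ?A \<union> ?B"
  proof (cases "x = 1")
    case True
    hence "d \<in> comps n" using c d by (auto simp: comps_def)
    thus ?thesis using True d by blast
  next
    case False
    then obtain y where y: "x = Suc y" "y > 0" using c d by (cases x) (auto simp: comps_def)
    hence "d @ [y] \<in> comps n - {[]}" using c d by (auto simp: comps_def)
    moreover have "c = butlast (d @ [y]) @ [Suc (last (d @ [y]))]" using d y by simp
    ultimately show ?thesis by blast
  qed
next
  fix c assume "c \<in> ?A \<union> ?B"
  thus "c \<in> comps (Suc n)"
  proof
    assume "c \<in> ?A"
    thus ?thesis by (auto simp: comps_def)
  next
    assume "c \<in> ?B"
    then obtain e where e: "e \<in> comps n" "e \<noteq> []" "c = butlast e @ [Suc (last e)]" by auto
    from e(2) obtain d y where "e = d @ [y]" by (cases e rule: rev_cases) auto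
    thus ?thesis using e by (auto simp: comps_def)
  qed
qed

lemma finite_comps: "finite (comps n)"
  by (induction n) (auto simp: comps_0 comps_Suc)

lemma sum_comps_Suc:
  assumes "n > 0"
  shows "(\<Sum>c\<in>comps (Suc n). \<phi> c) = (\<Sum>c\<in>comps n. \<phi> (c @ [1]) + \<phi> (butlast c @ [Suc (last c)]))"
proof -
  have ne: "c \<noteq> []" if "c \<in> comps n" for c using that assms by (auto simp: comps_def)
  hence minus: "comps n - {[]} = comps n" by auto
  have pos: "last c > 0" if "c \<in> comps n" for c
    using ne[OF that] that by (auto simp: comps_def)
  have inj: "inj_on (\<lambda>c. butlast c @ [Suc (last c)]) (comps n)"
    by (rule inj_onI) (metis append_butlast_last_id append1_eq_conv nat.inject ne)
  \<comment> \<open>The two images are disjoint: parts are positive, so a raised last part is at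
    least 2.\<close>
  have "(\<Sum>c\<in>comps (Suc n). \<phi> c) = (\<Sum>c\<in>(\<lambda>c. c @ [1]) ` comps n. \<phi> c) +
      (\<Sum>c\<in>(\<lambda>c. butlast c @ [Suc (last c)]) ` comps n. \<phi> c)"
    unfolding comps_Suc minus
    by (rule sum.union_disjoint) (use finite_comps in \<open>auto dest: pos\<close>)
  also have "\<dots> = (\<Sum>c\<in>comps n. \<phi> (c @ [1])) + (\<Sum>c\<in>comps n. \<phi> (butlast c @ [Suc (last c)]))"
    using inj by (simp add: sum.reindex inj_on_def o_def)
  finally show ?thesis by (simp add: sum.distrib)
qed

lemma sum_list_take_nth_le:
  fixes c :: "nat list"
  assumes "i < length c"
  shows "sum_list (take i c) + c ! i \<le> sum_list c"
proof -
  have "sum_list c = sum_list (take (Suc i) c) + sum_list (drop (Suc i) c)"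
    by (metis append_take_drop_id sum_list_append)
  thus ?thesis using assms by (simp add: take_Suc_conv_app_nth)
qed

lemma blk_snoc:
  assumes "sum_list c = length q" "i < length c"
  shows "blk (c @ d) i (q @ [a]) = blk c i q"
  using assms sum_list_take_nth_le[OF assms(2)] by (simp add: blk_def nth_append)

lemma blk_snoc_one:
  assumes "sum_list c = length q"
  shows "blk (c @ [1]) (length c) (q @ [a]) = [a]"
  using assms by (simp add: blk_def)

lemma blk_extend:
  assumes "sum_list c = length q" "c \<noteq> []"
  shows "i < length c - 1 \<Longrightarrow> blk (butlast c @ [Suc (last c)]) i (q @ [a]) = blk c i q"
    and "blk (butlast c @ [Suc (last c)]) (length c - 1) (q @ [a]) = blk c (length c - 1) q @ [a]"
proof -
  obtain d y where c: "c = d @ [y]" using assms(2) by (cases c rule: rev_cases) auto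
  have s: "sum_list d + y = length q" using assms c by simp
  show "blk (butlast c @ [Suc (last c)]) i (q @ [a]) = blk c i q" if "i < length c - 1"
    using sum_list_take_nth_le[of i d] that s by (simp add: c blk_def nth_append)
  show "blk (butlast c @ [Suc (last c)]) (length c - 1) (q @ [a]) = blk c (length c - 1) q @ [a]"
    using s by (simp add: c blk_def)
qed

lemma f_fun_Nil: "f_fun [] [] \<theta> = 1"
  using f_fun_zeros[of "[]" "[]" \<theta>] by (simp add: Bc_def)

lemma length_blk_eq: "length q = length r \<Longrightarrow> length (blk c i q) = length (blk c i r)"
  by (simp add: blk_def)

lemma continuous_on_F_fun:
  assumes "length q = length r"
  shows "continuous_on A (F_fun q r)"
  unfolding F_fun_def[abs_def]
  by (cases "q = []") (auto intro!: continuous_intros continuous_on_f_fun length_blk_eq assms)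

text \<open>Each composition contributes a multiple of f(\<theta>) - f(0) for its last block.
  Against the new form, f(\<theta>) integrates to the block lengthened by the new entry, while the
  constant f(0) leads to a new block made of that entry alone, with one more sign. These are exactly
  the two ways of extending a composition.\<close>

lemma has_integral_F_fun_snoc:
  assumes len: "length q = length r" and \<sigma>: "0 \<le> \<sigma>" "\<sigma> \<le> 2 * pi"
  shows "((\<lambda>\<theta>. \<i> * (\<i> * of_real \<theta>) ^ a * Li1_circle \<theta> ^ b * F_fun q r \<theta>) has_integral
    F_fun (q @ [a]) (r @ [b]) \<sigma>) {0..\<sigma>}"
proof (cases "q = []")
  case True
  hence "r = []" using len by simp
  moreover have "comps (Suc 0) = {[1]}" by (simp add: comps_Suc comps_0)
  hence "F_fun [a] [b] \<sigma> = f_fun [a] [b] \<sigma> - f_fun [a] [b] 0"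
    by (simp add: F_fun_def blk_def)
  ultimately show ?thesis
    using has_integral_f_fun_snoc[of "[]" "[]" \<sigma> a b] \<sigma> True by (simp add: f_fun_Nil F_fun_def)
next
  case False
  define n where "n = length q"
  have n: "n > 0" "length r = n" using False len by (auto simp: n_def)
  define pr where "pr = (\<lambda>c. (-1) ^ (length c - 1) * (\<Prod>i<length c - 1. f_fun (blk c i q) (blk c i r) 0))"
  define ql rl where "ql = (\<lambda>c. blk c (length c - 1) q)" and "rl = (\<lambda>c. blk c (length c - 1) r)"
  define W where "W = (\<lambda>\<theta>. \<i> * (\<i> * of_real \<theta>) ^ a * Li1_circle \<theta> ^ b)"
  define inc where "inc = (\<lambda>c :: nat list. butlast c @ [Suc (last c)])"
  define \<phi> where "\<phi> = (\<lambda>c. (-1) ^ (length c - 1)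
        * (\<Prod>i<length c - 1. f_fun (blk c i (q @ [a])) (blk c i (r @ [b])) 0)
        * (f_fun (blk c (length c - 1) (q @ [a])) (blk c (length c - 1) (r @ [b])) \<sigma>
           - f_fun (blk c (length c - 1) (q @ [a])) (blk c (length c - 1) (r @ [b])) 0))"
  have c: "c \<noteq> []" "sum_list c = length q" "sum_list c = length r" if "c \<in> comps n" for c
    using that n by (auto simp: comps_def n_def)
  have one: "\<phi> (c @ [1]) = - pr c * f_fun (ql c) (rl c) 0 * (f_fun [a] [b] \<sigma> - f_fun [a] [b] 0)"
    if cn: "c \<in> comps n" for c
  proof -
    obtain h where h: "length c = Suc h" using c(1)[OF cn] by (cases c) auto
    \<comment> \<open>The former last block is now an inner one: its value at 0 joins the product,
      and the sign flips.\<close>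
    have "(\<Prod>i<length c. f_fun (blk (c @ [1]) i (q @ [a])) (blk (c @ [1]) i (r @ [b])) 0) =
      (\<Prod>i<length c. f_fun (blk c i q) (blk c i r) 0)"
      using c[OF that] by (intro prod.cong refl) (simp add: blk_snoc)
    also have "\<dots> = (\<Prod>i<length c - 1. f_fun (blk c i q) (blk c i r) 0) * f_fun (ql c) (rl c) 0"
      by (simp add: h ql_def rl_def)
    finally have "(\<Prod>i<length c. f_fun (blk (c @ [1]) i (q @ [a])) (blk (c @ [1]) i (r @ [b])) 0) =
      (\<Prod>i<length c - 1. f_fun (blk c i q) (blk c i r) 0) * f_fun (ql c) (rl c) 0" .
    moreover have "blk (c @ [1]) (length c) (q @ [a]) = [a]" "blk (c @ [1]) (length c) (r @ [b]) = [b]"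
      using c[OF cn] by (simp_all only: blk_snoc_one)
    moreover have "length (c @ [1]) - 1 = length c" by simp
    moreover have "(-1 :: complex) ^ length c = - ((-1) ^ (length c - 1))" by (simp add: h)
    ultimately show ?thesis unfolding \<phi>_def pr_def by (simp only: mult_minus_left mult.assoc)
  qed
  have two: "\<phi> (inc c) = pr c * (f_fun (ql c @ [a]) (rl c @ [b]) \<sigma> - f_fun (ql c @ [a]) (rl c @ [b]) 0)"
    if "c \<in> comps n" for c
  proof -
    have "length (inc c) = length c" using c[OF that] by (simp add: inc_def)
    moreover have "(\<Prod>i<length c - 1. f_fun (blk (inc c) i (q @ [a])) (blk (inc c) i (r @ [b])) 0) =
      (\<Prod>i<length c - 1. f_fun (blk c i q) (blk c i r) 0)"
      unfolding inc_def using c[OF that] by (intro prod.cong refl) (simp add: blk_extend(1))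
    moreover have "blk (inc c) (length c - 1) (q @ [a]) = ql c @ [a]"
        "blk (inc c) (length c - 1) (r @ [b]) = rl c @ [b]"
      using c[OF that] by (simp_all only: inc_def ql_def rl_def blk_extend(2) not_False_eq_True)
    ultimately show ?thesis unfolding \<phi>_def pr_def by (simp only:)
  qed
  have F': "F_fun (q @ [a]) (r @ [b]) \<sigma> = (\<Sum>c\<in>comps n.
      - pr c * f_fun (ql c) (rl c) 0 * (f_fun [a] [b] \<sigma> - f_fun [a] [b] 0) +
      pr c * (f_fun (ql c @ [a]) (rl c @ [b]) \<sigma> - f_fun (ql c @ [a]) (rl c @ [b]) 0))"
  proof -
    have "F_fun (q @ [a]) (r @ [b]) \<sigma> = (\<Sum>c\<in>comps (Suc n). \<phi> c)"
      by (simp add: F_fun_def \<phi>_def n_def)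
    thus ?thesis using one two by (simp add: sum_comps_Suc[OF n(1)] inc_def)
  qed
  \<comment> \<open>Writing the constant as a multiple of \<open>f_fun [] [] \<theta> = 1\<close>
    brings it under the integration rule for \<open>f_fun\<close> too.\<close>
  have F: "W \<theta> * F_fun q r \<theta> = (\<Sum>c\<in>comps n.
      - pr c * f_fun (ql c) (rl c) 0 * (W \<theta> * f_fun [] [] \<theta>) + pr c * (W \<theta> * f_fun (ql c) (rl c) \<theta>))" for \<theta>
    using False
    by (simp add: F_fun_def n_def[symmetric] pr_def ql_def rl_def f_fun_Nil sum_distrib_left algebra_simps)
  have 1: "((\<lambda>\<theta>. W \<theta> * f_fun [] [] \<theta>) has_integral f_fun [a] [b] \<sigma> - f_fun [a] [b] 0) {0..\<sigma>}"
    using has_integral_f_fun_snoc[of "[]" "[]" \<sigma> a b] \<sigma> by (simp add: W_def)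
  have 2: "((\<lambda>\<theta>. W \<theta> * f_fun (ql c) (rl c) \<theta>) has_integral
      f_fun (ql c @ [a]) (rl c @ [b]) \<sigma> - f_fun (ql c @ [a]) (rl c @ [b]) 0) {0..\<sigma>}" for c
    unfolding W_def ql_def rl_def by (intro has_integral_f_fun_snoc length_blk_eq len \<sigma>)
  have "((\<lambda>\<theta>. W \<theta> * F_fun q r \<theta>) has_integral F_fun (q @ [a]) (r @ [b]) \<sigma>) {0..\<sigma>}"
    unfolding F F'
    by (intro has_integral_sum finite_comps has_integral_add has_integral_mult_right 1 2)
  thus ?thesis by (simp add: W_def)
qed

subsection \<open>Expansion of the log-sine integral\<close>

definition trisplit :: "nat \<Rightarrow> (nat \<times> nat \<times> nat) set" where
  "trisplit m = {(p, q, r). p + q + r = m}"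

lemma finite_trisplit: "finite (trisplit m)"
  by (rule finite_subset[of _ "{..m} \<times> {..m} \<times> {..m}"]) (auto simp: trisplit_def)

lemma trinomial:
  fixes x y z :: "'a :: field_char_0"
  shows "(x + y + z) ^ m = (\<Sum>(p, q, r)\<in>trisplit m.
    fact m / (fact p * fact q * fact r) * x ^ p * y ^ q * z ^ r)"
proof -
  have "(x + y + z) ^ m = (\<Sum>p\<le>m. of_nat (m choose p) * x ^ p * (y + z) ^ (m - p))"
    by (simp add: binomial_ring add.assoc)
  also have "\<dots> = (\<Sum>p\<le>m. \<Sum>q\<le>m - p.
      fact m / (fact p * fact q * fact (m - p - q)) * x ^ p * y ^ q * z ^ (m - p - q))"
    unfolding binomial_ring sum_distrib_left
    by (intro sum.cong refl) (simp add: binomial_fact mult_ac)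
  also have "\<dots> = (\<Sum>(p, q)\<in>(SIGMA p:{..m}. {..m - p}).
      fact m / (fact p * fact q * fact (m - p - q)) * x ^ p * y ^ q * z ^ (m - p - q))"
    by (rule sum.Sigma) auto
  also have "\<dots> = (\<Sum>(p, q, r)\<in>trisplit m.
    fact m / (fact p * fact q * fact r) * x ^ p * y ^ q * z ^ r)"
    by (rule sum.reindex_bij_witness[of _ "\<lambda>(p, q, r). (p, q)" "\<lambda>(p, q). (p, q, m - p - q)"])
      (auto simp: trisplit_def)
  finally show ?thesis .
qed

definition index_splits :: "nat list \<Rightarrow> nat list \<Rightarrow> (nat list \<times> nat list \<times> nat list) set" where
  "index_splits k l = {(p, q, r). length p = length k \<and> length q = length k \<and> length r = length k \<and>
     (\<forall>u<length k. p ! u + q ! u + r ! u = k ! u - 1 - l ! u)}"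

lemma index_splits_snoc:
  assumes "length l = length k"
  shows "(p @ [p'], q @ [q'], r @ [r']) \<in> index_splits (k @ [\<kappa>]) (l @ [\<mu>]) \<longleftrightarrow>
    (p, q, r) \<in> index_splits k l \<and> (p', q', r') \<in> trisplit (\<kappa> - 1 - \<mu>)"
  using assms
  by (auto simp: index_splits_def trisplit_def All_less_Suc nth_append)

lemma index_splits_butlast:
  assumes "length l = length k" "(p, q, r) \<in> index_splits (k @ [\<kappa>]) (l @ [\<mu>])"
  shows "butlast p @ [last p] = p" "butlast q @ [last q] = q" "butlast r @ [last r] = r"
    and "(butlast p, butlast q, butlast r) \<in> index_splits k l"
    and "(last p, last q, last r) \<in> trisplit (\<kappa> - Suc \<mu>)"
proof -
  have "p \<noteq> []" "q \<noteq> []" "r \<noteq> []" using assms(2) by (auto simp: index_splits_def)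
  thus *: "butlast p @ [last p] = p" "butlast q @ [last q] = q" "butlast r @ [last r] = r"
    by simp_all
  show "(butlast p, butlast q, butlast r) \<in> index_splits k l"
    "(last p, last q, last r) \<in> trisplit (\<kappa> - Suc \<mu>)"
    using index_splits_snoc[OF assms(1), of "butlast p" "last p" "butlast q" "last q" "butlast r" "last r"]
      assms(2) by (simp_all add: *)
qed

lemma sum_index_splits_snoc:
  assumes "length l = length k"
  shows "(\<Sum>(p, q, r)\<in>index_splits (k @ [\<kappa>]) (l @ [\<mu>]). \<phi> p q r) =
    (\<Sum>(p, q, r)\<in>index_splits k l. \<Sum>(p', q', r')\<in>trisplit (\<kappa> - 1 - \<mu>). \<phi> (p @ [p']) (q @ [q']) (r @ [r']))"
proof -
  have "(\<Sum>(p, q, r)\<in>index_splits k l. \<Sum>(p', q', r')\<in>trisplit (\<kappa> - 1 - \<mu>). \<phi> (p @ [p']) (q @ [q']) (r @ [r'])) =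
    (\<Sum>((p, q, r), (p', q', r'))\<in>index_splits k l \<times> trisplit (\<kappa> - 1 - \<mu>). \<phi> (p @ [p']) (q @ [q']) (r @ [r']))"
    by (simp add: sum.cartesian_product case_prod_unfold)
  also have "\<dots> = (\<Sum>(p, q, r)\<in>index_splits (k @ [\<kappa>]) (l @ [\<mu>]). \<phi> p q r)"
    by (rule sum.reindex_bij_witness[of _
          "\<lambda>(p, q, r). ((butlast p, butlast q, butlast r), (last p, last q, last r))"
          "\<lambda>((p, q, r), (p', q', r')). (p @ [p'], q @ [q'], r @ [r'])"])
      (auto simp: index_splits_snoc[OF assms] index_splits_butlast[OF assms])
  finally show ?thesis ..
qed

lemma finite_index_splits: "finite (index_splits k l)"
proof (rule finite_subset)
  let ?L = "{p. set p \<subseteq> {..sum_list k} \<and> length p = length k}"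
  show "finite (?L \<times> ?L \<times> ?L)" by (intro finite_cartesian_product finite_lists_length_eq) auto
  show "index_splits k l \<subseteq> ?L \<times> ?L \<times> ?L"
  proof
    fix x assume "x \<in> index_splits k l"
    moreover obtain p q r where x: "x = (p, q, r)" by (cases x)
    ultimately have pqr: "(p, q, r) \<in> index_splits k l" by simp
    have "x ! u \<le> sum_list k" if "x \<in> {p, q, r}" "u < length k" for x u
    proof -
      have "x ! u \<le> p ! u + q ! u + r ! u" using that by auto
      also have "\<dots> = k ! u - 1 - l ! u" using pqr that by (simp add: index_splits_def)
      also have "\<dots> \<le> k ! u" by simp
      also have "\<dots> \<le> sum_list k" using that by (intro elem_le_sum_list)
      finally show ?thesis .
    qed
    thus "x \<in> ?L \<times> ?L \<times> ?L"
      using pqr unfolding x by (auto simp: index_splits_def set_conv_nth)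
  qed
qed

definition split_weight ::
  "nat list \<Rightarrow> nat list \<Rightarrow> nat list \<Rightarrow> nat list \<Rightarrow> nat list \<Rightarrow> complex" where
  "split_weight k l p q r = (- \<i> * of_real pi) ^ sum_list p / 2 ^ (sum_list p + sum_list q)
       * (\<Prod>u<length k. fact (k ! u - 1 - l ! u) / (fact (p ! u) * fact (q ! u) * fact (r ! u)))"

lemma split_weight_snoc:
  assumes "length l = length k" "(p, q, r) \<in> index_splits k l"
  shows "split_weight (k @ [\<kappa>]) (l @ [\<mu>]) (p @ [p']) (q @ [q']) (r @ [r']) = split_weight k l p q r *
    ((- \<i> * of_real pi) ^ p' / 2 ^ (p' + q') *
     (fact (\<kappa> - 1 - \<mu>) / (fact p' * fact q' * fact r')))"
proof -
  have "length p = length k" "length q = length k" "length r = length k"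
    using assms(2) by (auto simp: index_splits_def)
  thus ?thesis using assms(1)
    by (simp add: split_weight_def nth_append power_add mult_ac)
qed

lemma Lsint_rev_eq_Ls: "Lsint_rev (rev k) (rev l) \<theta> = (-1) ^ length k * Ls k l \<theta>"
  by (simp add: Ls_def flip: power_add mult.assoc)

lemma Ls_snoc:
  "Ls (k @ [\<kappa>]) (l @ [\<mu>]) \<sigma> =
    - (LBINT \<theta>=0..\<sigma>. \<theta> ^ \<mu> * Acl \<theta> ^ (\<kappa> - 1 - \<mu>) * Ls k l \<theta>)"
proof -
  have "(LBINT \<theta>=0..\<sigma>. \<theta> ^ \<mu> * Acl \<theta> ^ (\<kappa> - 1 - \<mu>) * Lsint_rev (rev k) (rev l) \<theta>) =
    (LBINT \<theta>=0..\<sigma>. (-1) ^ length k * (\<theta> ^ \<mu> * Acl \<theta> ^ (\<kappa> - 1 - \<mu>) * Ls k l \<theta>))"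
    by (simp add: Lsint_rev_eq_Ls mult_ac)
  also have "\<dots> = (-1) ^ length k * (LBINT \<theta>=0..\<sigma>. \<theta> ^ \<mu> * Acl \<theta> ^ (\<kappa> - 1 - \<mu>) * Ls k l \<theta>)"
    by (rule interval_lebesgue_integral_mult_right)
  finally show ?thesis
    by (simp add: Ls_def[of "k @ [\<kappa>]"] flip: power_add mult.assoc)
qed

text \<open>Of the three summands of -A only the first two carry a factor 1/2, hence the exponent
  \<open>p + q\<close> of 2.\<close>

lemma Acl_power_expansion:
  assumes "0 < \<theta>" "\<theta> < 2 * pi"
  shows "of_real (Acl \<theta> ^ m) = (-1) ^ m * (\<Sum>(p, q, r)\<in>trisplit m.
    (- \<i> * of_real pi) ^ p / 2 ^ (p + q) * (fact m / (fact p * fact q * fact r)) *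
    (\<i> * of_real \<theta>) ^ q * Li1_circle \<theta> ^ r)"
proof -
  have "of_real (Acl \<theta>) = - (- \<i> * of_real pi / 2 + \<i> * of_real \<theta> / 2 + Li1_circle \<theta>)"
    by (simp add: Li1_circle_eq[OF assms])
  hence "of_real (Acl \<theta> ^ m) = (-1) ^ m * (- \<i> * of_real pi / 2 + \<i> * of_real \<theta> / 2 + Li1_circle \<theta>) ^ m"
    by (metis of_real_power power_minus)
  thus ?thesis
    unfolding trinomial power_divide power_add by (simp add: mult_ac)
qed

lemma Ls_eq_sum_F_fun:
  assumes "length l = length k" "\<forall>u<length k. l ! u + 1 \<le> k ! u" "0 \<le> \<sigma>" "\<sigma> \<le> 2 * pi"
  shows "complex_of_real (Ls k l \<sigma>) = \<i> ^ (sum_list l + length k) * (-1) ^ (sum_list k + length k) *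
    (\<Sum>(p, q, r)\<in>index_splits k l. split_weight k l p q r * F_fun (map2 (+) q l) r \<sigma>)"
  using assms
proof (induction k arbitrary: l \<sigma> rule: rev_induct)
  case Nil
  have "index_splits [] [] = {([], [], [])}" by (auto simp: index_splits_def)
  thus ?case using Nil by (simp add: Ls_def split_weight_def F_fun_def)
next
  case (snoc \<kappa> k l')
  obtain l \<mu> where l': "l' = l @ [\<mu>]" using snoc.prems(1) by (cases l' rule: rev_cases) auto
  have len: "length l = length k" using snoc.prems(1) l' by simp
  have k: "\<forall>u<length k. l ! u + 1 \<le> k ! u" and \<kappa>: "\<mu> + 1 \<le> \<kappa>"
    using snoc.prems(2) len by (auto simp: l' All_less_Suc nth_append)
  define m where "m = \<kappa> - 1 - \<mu>"
  define c :: complex where "c = \<i> ^ (sum_list l + length k) * (-1) ^ (sum_list k + length k)"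
  \<comment> \<open>Chosen so that \<open>c' * \<i> * (\<i> * \<theta>) ^ \<mu>\<close> equals
    \<open>- c * (-1) ^ m * \<theta> ^ \<mu>\<close>: \<open>\<i> * \<i>\<close> is the sign in
    \<open>Ls_snoc\<close>, the powers of \<open>\<i>\<close> cancel by
    \<open>\<i> ^ \<mu> * \<i> ^ \<mu> * (-1) ^ \<mu> = 1\<close>, and \<open>(-1) ^ m\<close> comes
    from the m-th power of A.\<close>
  define c' :: complex where "c' = c * \<i> ^ (\<mu> + 1) * (-1) ^ (m + \<mu>)"
  define w :: "nat \<Rightarrow> nat \<Rightarrow> nat \<Rightarrow> complex" where
    "w = (\<lambda>p q r. (- \<i> * of_real pi) ^ p / 2 ^ (p + q) * (fact m / (fact p * fact q * fact r)))"
  have lens: "length (fst (snd x)) = length l \<and> length (snd (snd x)) = length l" if "x \<in> index_splits k l" for x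
    using that len by (auto simp: index_splits_def)
  have IH: "complex_of_real (Ls k l \<theta>) =
      c * (\<Sum>(p, q, r)\<in>index_splits k l. split_weight k l p q r * F_fun (map2 (+) q l) r \<theta>)"
    if "0 \<le> \<theta>" "\<theta> \<le> 2 * pi" for \<theta>
    unfolding c_def by (rule snoc.IH[OF len k that])
  \<comment> \<open>Continuity of the inner integral is read off from the closed form in the
    induction hypothesis; the real part only leads back to real values.\<close>
  have cont: "continuous_on {0..\<sigma>} (Ls k l)"
  proof -
    have "continuous_on {0..\<sigma>} (\<lambda>\<theta>. Re (c * (\<Sum>(p, q, r)\<in>index_splits k l.
        split_weight k l p q r * F_fun (map2 (+) q l) r \<theta>)))"
      unfolding case_prod_unfold
      using lens by (intro continuous_intros continuous_on_F_fun) auto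
    thus ?thesis
    proof (rule continuous_on_eq)
      fix \<theta> assume "\<theta> \<in> {0..\<sigma>}"
      hence *: "0 \<le> \<theta>" "\<theta> \<le> 2 * pi" using snoc.prems(4) by auto
      show "Re (c * (\<Sum>(p, q, r)\<in>index_splits k l. split_weight k l p q r * F_fun (map2 (+) q l) r \<theta>)) =
          Ls k l \<theta>"
        unfolding IH[OF *, symmetric] by (rule Re_complex_of_real)
    qed
  qed
  let ?f = "\<lambda>\<theta>. \<theta> ^ \<mu> * Acl \<theta> ^ m * Ls k l \<theta>"
  have si: "set_integrable lborel {0..\<sigma>} ?f"
    by (rule Acl_set_integrable[OF cont snoc.prems(3,4)])
  have "(?f has_integral (LBINT \<theta>=0..\<sigma>. ?f \<theta>)) {0..\<sigma>}"
    using set_borel_integral_eq_integral(1)[OF si] interval_integral_eq_integral[OF snoc.prems(3) si]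
    by (simp add: has_integral_integral zero_ereal_def)
  from has_integral_neg[OF has_integral_linear[OF this bounded_linear_of_real]]
  have 1: "((\<lambda>\<theta>. - complex_of_real (?f \<theta>)) has_integral of_real (Ls (k @ [\<kappa>]) l' \<sigma>)) {0..\<sigma>}"
    by (simp add: l' Ls_snoc m_def o_def)
  have 2: "((\<lambda>\<theta>. c' * (\<Sum>(p, q, r)\<in>index_splits k l. \<Sum>(p', q', r')\<in>trisplit m.
      split_weight k l p q r * w p' q' r' *
        (\<i> * (\<i> * of_real \<theta>) ^ (q' + \<mu>) * Li1_circle \<theta> ^ r' * F_fun (map2 (+) q l) r \<theta>))) has_integral
      c' * (\<Sum>(p, q, r)\<in>index_splits k l. \<Sum>(p', q', r')\<in>trisplit m.
        split_weight k l p q r * w p' q' r' *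
          F_fun (map2 (+) q l @ [q' + \<mu>]) (r @ [r']) \<sigma>)) {0..\<sigma>}"
    unfolding case_prod_unfold
    using lens
    by (intro has_integral_mult_right has_integral_sum finite_index_splits finite_trisplit
          has_integral_F_fun_snoc snoc.prems(3,4)) auto
  \<comment> \<open>The formula for A holds strictly between 0 and 2 pi, hence the open interval;
    the integral is unaffected.\<close>
  have eq: "- complex_of_real (?f \<theta>) = c' * (\<Sum>(p, q, r)\<in>index_splits k l. \<Sum>(p', q', r')\<in>trisplit m.
      split_weight k l p q r * w p' q' r' *
        (\<i> * (\<i> * of_real \<theta>) ^ (q' + \<mu>) * Li1_circle \<theta> ^ r' * F_fun (map2 (+) q l) r \<theta>))"
    if \<theta>: "\<theta> \<in> {0<..<\<sigma>}" for \<theta>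
  proof -
    have \<theta>': "0 < \<theta>" "\<theta> < 2 * pi" using \<theta> snoc.prems(4) by auto
    define Sm where "Sm = (\<Sum>(p, q, r)\<in>index_splits k l. split_weight k l p q r * F_fun (map2 (+) q l) r \<theta>)"
    define Tm where "Tm = (\<Sum>(p, q, r)\<in>trisplit m. w p q r * (\<i> * of_real \<theta>) ^ q * Li1_circle \<theta> ^ r)"
    have "(\<Sum>(p, q, r)\<in>index_splits k l. \<Sum>(p', q', r')\<in>trisplit m.
      split_weight k l p q r * w p' q' r' *
        (\<i> * (\<i> * of_real \<theta>) ^ (q' + \<mu>) * Li1_circle \<theta> ^ r' * F_fun (map2 (+) q l) r \<theta>)) =
      \<i> * (\<i> * of_real \<theta>) ^ \<mu> * (Sm * Tm)"
      unfolding Sm_def Tm_def sum_product case_prod_unfold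
      unfolding sum_distrib_left
      by (intro sum.cong refl) (simp add: power_add mult_ac)
    also have "c' * \<dots> = - (of_real (\<theta> ^ \<mu>) * ((-1) ^ m * Tm) * (c * Sm)) * (\<i> ^ \<mu> * \<i> ^ \<mu> * (-1) ^ \<mu>)"
      by (simp add: c'_def power_add power_mult_distrib mult_ac)
    also have "\<i> ^ \<mu> * \<i> ^ \<mu> * (-1) ^ \<mu> = (1 :: complex)"
      by (simp flip: power_mult_distrib)
    also have "(-1) ^ m * Tm = of_real (Acl \<theta> ^ m)"
      using Acl_power_expansion[OF \<theta>', of m] by (simp add: Tm_def w_def)
    also have "c * Sm = of_real (Ls k l \<theta>)"
      using IH[of \<theta>] \<theta>' by (simp add: Sm_def)
    finally show ?thesis by simp
  qed
  have "((\<lambda>\<theta>. - complex_of_real (?f \<theta>)) has_integral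
      c' * (\<Sum>(p, q, r)\<in>index_splits k l. \<Sum>(p', q', r')\<in>trisplit m.
        split_weight k l p q r * w p' q' r' *
          F_fun (map2 (+) q l @ [q' + \<mu>]) (r @ [r']) \<sigma>)) {0..\<sigma>}"
    using 2 unfolding has_integral_Icc_iff_Ioo by (subst has_integral_cong[OF eq])
  with 1 have "of_real (Ls (k @ [\<kappa>]) l' \<sigma>) =
      c' * (\<Sum>(p, q, r)\<in>index_splits k l. \<Sum>(p', q', r')\<in>trisplit m.
        split_weight k l p q r * w p' q' r' * F_fun (map2 (+) q l @ [q' + \<mu>]) (r @ [r']) \<sigma>)"
    by (rule has_integral_unique)
  also have "c' = \<i> ^ (sum_list l' + length (k @ [\<kappa>])) * (-1) ^ (sum_list (k @ [\<kappa>]) + length (k @ [\<kappa>]))"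
  proof -
    \<comment> \<open>The exponent of -1 grows by \<open>\<kappa> + 1 = m + \<mu> + 2\<close>, which
      has the parity of \<open>m + \<mu>\<close>.\<close>
    have "\<kappa> = m + \<mu> + 1" using \<kappa> by (simp add: m_def)
    thus ?thesis by (simp add: c'_def c_def l' power_add mult_ac)
  qed
  also have "(\<Sum>(p, q, r)\<in>index_splits k l. \<Sum>(p', q', r')\<in>trisplit m.
        split_weight k l p q r * w p' q' r' * F_fun (map2 (+) q l @ [q' + \<mu>]) (r @ [r']) \<sigma>) =
      (\<Sum>(p, q, r)\<in>index_splits (k @ [\<kappa>]) l'.
        split_weight (k @ [\<kappa>]) l' p q r * F_fun (map2 (+) q l') r \<sigma>)"
    unfolding l' sum_index_splits_snoc[OF len] m_def[symmetric]
  proof (intro sum.cong refl, clarify, intro sum.cong refl, clarify)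
    fix p q r p' q' r' assume pqr: "(p, q, r) \<in> index_splits k l"
    have "length q = length l" using pqr len by (simp add: index_splits_def)
    thus "split_weight k l p q r * w p' q' r' * F_fun (map2 (+) q l @ [q' + \<mu>]) (r @ [r']) \<sigma> =
      split_weight (k @ [\<kappa>]) (l @ [\<mu>]) (p @ [p']) (q @ [q']) (r @ [r']) *
        F_fun (map2 (+) (q @ [q']) (l @ [\<mu>])) (r @ [r']) \<sigma>"
      by (simp add: split_weight_snoc[OF len pqr] w_def m_def)
  qed
  finally show ?case .
qed

theorem theorem1:
  fixes \<sigma> :: real and k l :: "nat list"
  assumes "0 \<le> \<sigma>" and "\<sigma> \<le> 2 * pi"
    and "length l = length k"
    and "\<forall>u<length k. l ! u + 1 \<le> k ! u"
  shows "complex_of_real (Ls k l \<sigma>) =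
    \<i> ^ (sum_list l + length k) * (-1) ^ (sum_list k + length k) *
    (\<Sum>(p, q, r) \<in> {(p, q, r). length p = length k \<and> length q = length k \<and> length r = length k \<and>
                      (\<forall>u<length k. p ! u + q ! u + r ! u = k ! u - 1 - l ! u)}.
       (- \<i> * of_real pi) ^ sum_list p / 2 ^ (sum_list p + sum_list q)
       * (\<Prod>u<length k. fact (k ! u - 1 - l ! u) / (fact (p ! u) * fact (q ! u) * fact (r ! u)))
       * F_fun (map2 (+) q l) r \<sigma>)"
  using Ls_eq_sum_F_fun[OF assms(3,4,1,2)] unfolding index_splits_def split_weight_def .

end
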